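(* Let $F$ be a subfield of $\mathbb{R}$. Let $S\subseteq\mathbb{R}^n$ ($n\ge1$) be an $F$-rational polyhedral subset. Let $f: \mathrm{int}(S) \cap F^n \to \mathbb{R}$ be a function such that for every $F$-rational line $L\subseteq\mathbb{R}^n$, the restriction of $f$ to $\mathrm{int}(S)\cap F^n\cap L$ is $F$-integral polyhedral. Then $f$ is $F$-integral polyhedral.
   Context: $\mathrm{int}(S)$ denotes the relative interior of the convex set $S$, i.e. its topological interior relative to its affine hull. An affine functional $\lambda(x_1,\dots,x_n)=a_1x_1+\cdots+a_nx_n+b$ on $\mathbb{R}^n$ is $F$-integral if $a_1,\dots,a_n\in\mathbb{Z}$ and $b\in F$. An $F$-rational polyhedral subset of $\mathbb{R}^n$ is an intersection of finitely many (possibly zero) closed halfspaces $\{x:\lambda(x)\ge 0\}$ with each $\lambda$ an $F$-integral affine functional with $(a_1,\dots,a_n)\neq 0$ (it need not be bounded). An $F$-rational line is an affine line in $\mathbb{R}^n$ that is an $F$-rational polyhedral subset. For any $T\subseteq\mathbb{R}^n$, a function $g:T\to\mathbb{R}$ is $F$-integral polyhedral if $g(x)=\max\{\lambda_1(x),\dots,\lambda_m(x)\}$ for all $x\in T$, for some finite list of $F$-integral affine functionals $\lambda_1,\dots,\lambda_m$ on $\mathbb{R}^n$. *)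

theory Defs
  imports "HOL-Analysis.Analysis"
begin

definition real_subfield :: "real set \<Rightarrow> bool" where
  "real_subfield F \<longleftrightarrow>
     0 \<in> F \<and> 1 \<in> F \<and>
     (\<forall>x\<in>F. \<forall>y\<in>F. x + y \<in> F \<and> x * y \<in> F) \<and>
     (\<forall>x\<in>F. - x \<in> F) \<and>
     (\<forall>x\<in>F. x \<noteq> 0 \<longrightarrow> inverse x \<in> F)"

definition points_over :: "real set \<Rightarrow> (real ^ 'n) set" where
  "points_over F = {x. \<forall>i. x $ i \<in> F}"

text \<open>A pair \<open>(a, b)\<close> stands for the affine functional \<open>x \<mapsto> a \<bullet> x + b\<close>.\<close>

definition affine_eval :: "(real ^ 'n) \<times> real \<Rightarrow> real ^ 'n \<Rightarrow> real" where
  "affine_eval l x = fst l \<bullet> x + snd l"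

definition F_integral_functional :: "real set \<Rightarrow> (real ^ 'n) \<times> real \<Rightarrow> bool" where
  "F_integral_functional F l \<longleftrightarrow> (\<forall>i. fst l $ i \<in> \<int>) \<and> snd l \<in> F"

text \<open>The finite set \<open>H\<close> of functionals may be empty, in which case \<open>S\<close> is the whole space.\<close>

definition F_rational_polyhedral :: "real set \<Rightarrow> (real ^ 'n) set \<Rightarrow> bool" where
  "F_rational_polyhedral F S \<longleftrightarrow>
     (\<exists>H. finite H \<and> (\<forall>l\<in>H. F_integral_functional F l \<and> fst l \<noteq> 0) \<and>
          S = (\<Inter>l\<in>H. {x. affine_eval l x \<ge> 0}))"

definition F_rational_line :: "real set \<Rightarrow> (real ^ 'n) set \<Rightarrow> bool" where
  "F_rational_line F L \<longleftrightarrow> affine L \<and> aff_dim L = 1 \<and> F_rational_polyhedral F L"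

text \<open>Functions on \<open>T\<close> are represented by total functions, of which only the values
  on \<open>T\<close> are used. A maximum needs at least one functional, so \<open>M\<close> is nonempty.\<close>

definition F_integral_polyhedral_on ::
    "real set \<Rightarrow> (real ^ 'n) set \<Rightarrow> (real ^ 'n \<Rightarrow> real) \<Rightarrow> bool" where
  "F_integral_polyhedral_on F T g \<longleftrightarrow>
     (\<exists>M. finite M \<and> M \<noteq> {} \<and> (\<forall>l\<in>M. F_integral_functional F l) \<and>
          (\<forall>x\<in>T. g x = Max ((\<lambda>l. affine_eval l x) ` M)))"

end

theory Submission
  imports Defs
begin

text \<open>
  A local support of \<open>f\<close> at \<open>z\<close> is an integral linear minorant of the directional slopes of \<open>f\<close> at
  \<open>z\<close>. These slopes form an integer-valued sublinear function on a cone of lattice vectors, and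
  replacing such a function by its directional derivatives, one direction after another, makes it
  linear without leaving the integers. The inequality extends from directions with rational ratios to
  all of \<open>F\<^sup>n\<close> since \<open>f\<close> is continuous along rational lines. Supports also exist at the points of
  \<open>F\<^sup>n\<close> on the boundary, where \<open>f\<close> is replaced by its radial limit; comparing supports along
  rational rays, by induction on the dimension of the faces, shows that finitely many linear parts
  suffice.
\<close>

text \<open>An \<open>F\<close>-rational line has a rational direction. If \<open>F\<close> is
  larger than the rationals, two points of \<open>F^n\<close> need not lie on a common such line, so
  the hypothesis does not directly make \<open>f\<close> convex or continuous on its domain: both
  are at hand only along integral directions. A support is therefore built from integral directions
  alone and extended to the remaining points afterwards. Separation of convex sets would moreover
  give only real slopes; integral ones require an argument inside the lattice. Boundary points enter
  because of finiteness. The domain is relatively open, and the number of affine pieces may a priori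
  grow from line to line, so nothing in the hypothesis itself bounds the slopes uniformly. Since
  slopes are integers, a uniform bound is all that is needed. A walk along an integral direction
  that leaves the polyhedron does so at a point of \<open>F^n\<close>, and a support there bounds
  the slopes met before. A support at a boundary point is controlled by \<open>f\<close> only in the
  directions of its face, hence the count face by face.\<close>

section \<open>Lattice vectors and integral projections\<close>

lemma points_over_Ints [simp]:
  fixes v w :: "real ^ 'n"
  shows "0 \<in> (points_over \<int> :: (real ^ 'n) set)"
    and "axis i 1 \<in> (points_over \<int> :: (real ^ 'n) set)"
    and "v \<in> points_over \<int> \<Longrightarrow> w \<in> points_over \<int> \<Longrightarrow> v + w \<in> points_over \<int>"
    and "v \<in> points_over \<int> \<Longrightarrow> w \<in> points_over \<int> \<Longrightarrow> v - w \<in> points_over \<int>"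
    and "v \<in> points_over \<int> \<Longrightarrow> - v \<in> points_over \<int>"
    and "k \<in> \<int> \<Longrightarrow> v \<in> points_over \<int> \<Longrightarrow> k *\<^sub>R v \<in> points_over \<int>"
  by (auto simp: points_over_def axis_def)

lemma inner_Ints:
  "v \<in> points_over \<int> \<Longrightarrow> w \<in> points_over \<int> \<Longrightarrow> v \<bullet> w \<in> \<int>"
  by (auto simp: points_over_def inner_vec_def intro!: Ints_sum)

lemma vec_eq_sum_axis: "w = (\<Sum>i\<in>UNIV. w $ i *\<^sub>R axis i (1::real))"
  by (simp add: vec_eq_iff axis_def if_distrib cong: if_cong)

text \<open>The lattice vectors annihilated by \<open>H\<close> form a direct summand of the
  lattice. A further \<open>h\<close> is killed by subtracting from \<open>P w\<close> the multiple
  \<open>h \<bullet> P w / d\<close> of \<open>P u\<close>, where \<open>d = h \<bullet> P u\<close>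
  generates the values of \<open>h\<close> on the projected lattice, so that this multiple is an
  integer. \<open>P\<close> later turns coordinate directions into integral directions of a face,
  and extends linear forms from a sublattice to the whole lattice.\<close>

lemma integral_projection:
  fixes H :: "(real ^ 'n) set"
  assumes "finite H" "H \<subseteq> points_over \<int>"
  shows "\<exists>P. linear P \<and> (\<forall>w\<in>points_over \<int>. P w \<in> points_over \<int>) \<and>
           (\<forall>h\<in>H. \<forall>w. h \<bullet> P w = 0) \<and> (\<forall>w. (\<forall>h\<in>H. h \<bullet> w = 0) \<longrightarrow> P w = w)"
  using assms
proof (induction H rule: finite_induct)
  case empty
  show ?case by (rule exI[of _ "\<lambda>w. w"]) (auto simp: linear_id[unfolded id_def])
next
  case (insert h H)
  then obtain P where P: "linear P" "\<And>w. w \<in> points_over \<int> \<Longrightarrow> P w \<in> points_over \<int>"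
    "\<And>g w. g \<in> H \<Longrightarrow> g \<bullet> P w = 0" "\<And>w. (\<forall>g\<in>H. g \<bullet> w = 0) \<Longrightarrow> P w = w"
    by auto
  have h: "h \<in> points_over \<int>" using insert by auto
  show ?case
  proof (cases "\<forall>w\<in>points_over \<int>. h \<bullet> P w = 0")
    case True
    have "h \<bullet> P w = 0" for w
    proof -
      have "P w = (\<Sum>i\<in>UNIV. w $ i *\<^sub>R P (axis i 1))"
        by (subst vec_eq_sum_axis[of w]) (simp add: linear_sum[OF P(1)] linear_cmul[OF P(1)])
      then show ?thesis using True by (simp add: inner_sum_right)
    qed
    then show ?thesis using P by (intro exI[of _ P]) auto
  next
    case False
    then obtain w0 where w0: "w0 \<in> points_over \<int>" "h \<bullet> P w0 \<noteq> 0" by auto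
    define Q where "Q d \<longleftrightarrow> 0 < d \<and> (\<exists>u\<in>points_over \<int>. h \<bullet> P u = real d)" for d :: nat
    have int: "h \<bullet> P w \<in> \<int>" if "w \<in> points_over \<int>" for w
      using that P(2) h inner_Ints by blast
    have "\<exists>d. Q d"
    proof -
      obtain k where k: "h \<bullet> P w0 = of_int k" using int[OF w0(1)] by (auto elim: Ints_cases)
      have "h \<bullet> P (- w0) = of_int (- k)" using k by (simp add: linear_neg[OF P(1)])
      then have "Q (nat \<bar>k\<bar>)" using k w0 unfolding Q_def
        by (cases "k > 0") (auto intro: bexI[of _ w0] bexI[of _ "- w0"])
      then show ?thesis ..
    qed
    define d where "d = (LEAST d. Q d)"
    have d: "Q d" unfolding d_def using \<open>\<exists>d. Q d\<close> by (rule LeastI_ex)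
    then obtain u where u: "u \<in> points_over \<int>" "h \<bullet> P u = real d" "d > 0"
      unfolding Q_def by auto
    have dvd: "h \<bullet> P w / real d \<in> \<int>" if w: "w \<in> points_over \<int>" for w
    proof -
      obtain k where k: "h \<bullet> P w = of_int k" using int[OF w] by (auto elim: Ints_cases)
      \<comment> \<open>Division with remainder: a nonzero remainder would be a positive value below
        the least one.\<close>
      define v where "v = w - of_int (k div int d) *\<^sub>R u"
      have v: "v \<in> points_over \<int>" using w u unfolding v_def by simp
      have eq: "h \<bullet> P v = of_int (k mod int d)"
        unfolding v_def linear_diff[OF P(1)] linear_cmul[OF P(1)] inner_diff_right inner_scaleR_right k u
        by (simp add: minus_div_mult_eq_mod [symmetric])
      have "k mod int d = 0"
      proof (rule ccontr)
        assume "k mod int d \<noteq> 0"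
        moreover have "0 \<le> k mod int d" "k mod int d < int d" using u by auto
        ultimately have "Q (nat (k mod int d))" "nat (k mod int d) < d"
          unfolding Q_def using v eq by (auto intro!: bexI[of _ v])
        then show False using not_less_Least unfolding d_def by blast
      qed
      then have "k = k div int d * int d" by auto
      then have "real_of_int k / real d = of_int (k div int d)"
        using u by (metis nonzero_mult_div_cancel_right of_int_mult of_int_of_nat_eq of_nat_0_less_iff order_less_irrefl)
      then show ?thesis unfolding k by simp
    qed
    let ?P = "\<lambda>w. P w - (h \<bullet> P w / real d) *\<^sub>R P u"
    have "linear ?P"
      by (rule linearI) (simp_all add: linear_add[OF P(1)] linear_cmul[OF P(1)] inner_add_right
          algebra_simps add_divide_distrib)
    moreover have "\<forall>w\<in>points_over \<int>. ?P w \<in> points_over \<int>" using dvd P(2) u by simp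
    moreover have "\<forall>g\<in>insert h H. \<forall>w. g \<bullet> ?P w = 0"
      using P(3) u by (simp add: inner_diff_right)
    moreover have "\<forall>w. (\<forall>g\<in>insert h H. g \<bullet> w = 0) \<longrightarrow> ?P w = w" using P(4) by simp
    ultimately show ?thesis by (intro exI[of _ ?P]) blast
  qed
qed

section \<open>Integral linear minorants of sublinear functions\<close>

lemma antimono_int_eventually_constant:
  fixes s :: "nat \<Rightarrow> int"
  assumes dec: "\<And>j. s (Suc j) \<le> s j" and bdd: "\<And>j. b \<le> s j"
  shows "\<exists>N. \<forall>j\<ge>N. s j = s N"
proof -
  have anti: "antimono s" using dec by (intro decseq_SucI)
  obtain N where N: "\<And>j. nat (s N - b) \<le> nat (s j - b)"
    using ex_has_least_nat[of "\<lambda>_. True" 0 "\<lambda>j. nat (s j - b)"] by auto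
  have "s j = s N" if "j \<ge> N" for j
    using antimonoD[OF anti that] N[of j] bdd[of j] bdd[of N] by linarith
  then show ?thesis by blast
qed

text \<open>The stationary limit of \<open>K (m v + w) - m K v\<close> is the derivative of \<open>K\<close> at \<open>v\<close> in direction
  \<open>w\<close>. It is additive in direction \<open>v\<close>, and on \<open>C\<close> it minorizes \<open>K\<close>.\<close>

lemma directional_derivative:
  fixes K :: "'a::real_vector \<Rightarrow> int" and C L :: "'a set"
  assumes C_add: "\<And>w w'. w \<in> C \<Longrightarrow> w' \<in> C \<Longrightarrow> w + w' \<in> C"
    and L_add: "\<And>w w'. w \<in> L \<Longrightarrow> w' \<in> L \<Longrightarrow> w + w' \<in> L"
    and L_neg: "\<And>w. w \<in> L \<Longrightarrow> - w \<in> L"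
    and CL: "C \<subseteq> L"
    and absorb: "\<And>v w. v \<in> C \<Longrightarrow> w \<in> L \<Longrightarrow> \<exists>N. real N *\<^sub>R v + w \<in> C"
    and sub: "\<And>w w'. w \<in> C \<Longrightarrow> w' \<in> C \<Longrightarrow> K (w + w') \<le> K w + K w'"
    and hom: "\<And>w n. w \<in> C \<Longrightarrow> n \<ge> 1 \<Longrightarrow> K (real n *\<^sub>R w) = int n * K w"
    and v: "v \<in> C"
  shows "\<exists>D. (\<forall>w\<in>L. \<forall>w'\<in>L. D (w + w') \<le> D w + D w') \<and>
             (\<forall>w\<in>L. \<forall>n\<ge>1. D (real n *\<^sub>R w) = int n * D w) \<and>
             (\<forall>w\<in>C. D w \<le> K w) \<and>
             (\<forall>w\<in>L. D (v + w) = K v + D w) \<and>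
             (\<forall>u\<in>L. \<forall>k. (\<forall>w\<in>C. u + w \<in> C \<longrightarrow> K (u + w) = k + K w) \<longrightarrow>
                (\<forall>w\<in>L. D (u + w) = k + D w))"
proof -
  \<comment> \<open>Adding \<open>v\<close> once more raises \<open>K\<close> by at most
    \<open>K v\<close>, so the difference whose limit defines \<open>D\<close> never
    increases.\<close>
  have step: "real (m + n) *\<^sub>R v + w \<in> C \<and>
      K (real (m + n) *\<^sub>R v + w) \<le> K (real m *\<^sub>R v + w) + int n * K v"
    if "real m *\<^sub>R v + w \<in> C" for m n w
  proof (induction n)
    case (Suc n)
    have eq: "real (m + Suc n) *\<^sub>R v + w = (real (m + n) *\<^sub>R v + w) + v"
      by (simp add: algebra_simps)
    show ?case
      unfolding eq using C_add[of "real (m + n) *\<^sub>R v + w" v] sub[of "real (m + n) *\<^sub>R v + w" v] Suc v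
      by (auto simp: algebra_simps)
  qed (use that in auto)
  have "\<exists>k M. \<forall>m\<ge>M. real m *\<^sub>R v + w \<in> C \<and> K (real m *\<^sub>R v + w) - int m * K v = k" if w: "w \<in> L" for w
  proof -
    obtain N where N: "real N *\<^sub>R v + w \<in> C" using absorb v w by blast
    obtain R where R: "real R *\<^sub>R v + - w \<in> C" using absorb[of v "- w"] v w L_neg by blast
    define s where "s j = K (real (N + j) *\<^sub>R v + w) - int (N + j) * K v" for j
    have inC: "real (N + j) *\<^sub>R v + w \<in> C" for j using step[OF N] by blast
    have "s (Suc j) \<le> s j" for j
      using step[OF inC[of j], of 1] by (simp add: s_def algebra_simps)
    \<comment> \<open>Lower bound: the vectors for \<open>w\<close> and \<open>- w\<close> add up to
      a multiple of \<open>v\<close>, where \<open>K\<close> is known. The summand 1 keeps this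
      multiple positive, as \<open>hom\<close> requires; \<open>C\<close> need not contain
      0.\<close>
    moreover have "int (R+1) * K v - K (real (R+1) *\<^sub>R v + - w) \<le> s j" for j
    proof -
      have R': "real (R+1) *\<^sub>R v + - w \<in> C" using step[OF R, of 1] by blast
      have "(real (N + j) *\<^sub>R v + w) + (real (R+1) *\<^sub>R v + - w) = real (N + j + (R+1)) *\<^sub>R v"
        by (simp add: algebra_simps)
      then have "int (N + j + (R+1)) * K v \<le> K (real (N + j) *\<^sub>R v + w) + K (real (R+1) *\<^sub>R v + - w)"
        using sub[OF inC[of j] R'] hom[OF v, of "N + j + (R+1)"] by simp
      then show ?thesis unfolding s_def by (simp add: algebra_simps)
    qed
    ultimately obtain M where M: "\<forall>j\<ge>M. s j = s M"
      using antimono_int_eventually_constant[of s] by blast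
    have "real m *\<^sub>R v + w \<in> C \<and> K (real m *\<^sub>R v + w) - int m * K v = s M" if "m \<ge> N + M" for m
    proof -
      have m: "N + (m - N) = m" using that by simp
      have "M \<le> m - N" using that by simp
      then have "s (m - N) = s M" by (rule M[rule_format])
      then show ?thesis using inC[of "m - N"] s_def[of "m - N"] unfolding m by simp
    qed
    then show ?thesis by blast
  qed
  then have "\<forall>w. \<exists>k M. w \<in> L \<longrightarrow>
      (\<forall>m\<ge>M. real m *\<^sub>R v + w \<in> C \<and> K (real m *\<^sub>R v + w) - int m * K v = k)"
    by blast
  from choice[OF this] obtain D where "\<forall>w. \<exists>M. w \<in> L \<longrightarrow>
      (\<forall>m\<ge>M. real m *\<^sub>R v + w \<in> C \<and> K (real m *\<^sub>R v + w) - int m * K v = D w)"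
    by blast
  from choice[OF this] obtain M where DM: "\<And>w m. w \<in> L \<Longrightarrow> m \<ge> M w \<Longrightarrow> real m *\<^sub>R v + w \<in> C \<and>
      K (real m *\<^sub>R v + w) - int m * K v = D w"
    by blast
  have D: "K (real m *\<^sub>R v + w) = D w + int m * K v" "real m *\<^sub>R v + w \<in> C"
    if "w \<in> L" "m \<ge> M w" for w m using DM[OF that] by auto
  have D_sub: "D (w + w') \<le> D w + D w'" if w: "w \<in> L" "w' \<in> L" for w w'
  proof -
    define m where "m = max (M w) (max (M w') (M (w + w')))"
    have m: "M w \<le> m" "M w' \<le> m" "M (w + w') \<le> m + m" by (auto simp: m_def)
    have ww: "w + w' \<in> L" using w L_add by blast
    have eq: "real (m + m) *\<^sub>R v + (w + w') = (real m *\<^sub>R v + w) + (real m *\<^sub>R v + w')"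
      by (simp only: of_nat_add scaleR_left_distrib add_ac)
    have "D (w + w') + int (m + m) * K v \<le> (D w + int m * K v) + (D w' + int m * K v)"
      using sub[OF D(2)[OF w(1) m(1)] D(2)[OF w(2) m(2)]]
      unfolding D(1)[OF w(1) m(1)] D(1)[OF w(2) m(2)] eq[symmetric] D(1)[OF ww m(3)] .
    then show ?thesis by (simp add: algebra_simps)
  qed
  have D_hom: "D (real n *\<^sub>R w) = int n * D w" if w: "w \<in> L" and n: "n \<ge> 1" for w n
  proof -
    have nw: "real n *\<^sub>R w \<in> L" using n
    proof (induction n rule: nat_induct_at_least)
      case (Suc n) then show ?case using L_add[OF Suc.IH w] by (simp add: algebra_simps)
    qed (use w in simp)
    define m where "m = max (M w) (M (real n *\<^sub>R w))"
    have le: "M (real n *\<^sub>R w) \<le> n * m" "M w \<le> m"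
      using n mult_le_mono1[of 1 n m] unfolding m_def by auto
    have "real (n * m) *\<^sub>R v + real n *\<^sub>R w = real n *\<^sub>R (real m *\<^sub>R v + w)"
      by (simp add: algebra_simps)
    then show ?thesis
      using D(1)[OF nw le(1)] hom[OF D(2)[OF w le(2)] n] D(1)[OF w le(2)] by (simp add: algebra_simps)
  qed
  have D_le: "D w \<le> K w" if w: "w \<in> C" for w
    using D(1)[of w "M w"] step[of 0 w "M w"] w CL by auto
  \<comment> \<open>A direction in which \<open>K\<close> is already additive stays so, with the
    same constant. Thus repeated differentiation never loses linearity gained before.\<close>
  have D_add: "D (u + w) = k + D w"
    if u: "u \<in> L" and k: "\<forall>w\<in>C. u + w \<in> C \<longrightarrow> K (u + w) = k + K w" and w: "w \<in> L" for u k w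
  proof -
    define m where "m = max (M w) (M (u + w))"
    have m: "M w \<le> m" "M (u + w) \<le> m" by (auto simp: m_def)
    have uw: "u + w \<in> L" using u w L_add by blast
    have eq: "real m *\<^sub>R v + (u + w) = u + (real m *\<^sub>R v + w)" by (simp only: add_ac)
    have "K (u + (real m *\<^sub>R v + w)) = k + K (real m *\<^sub>R v + w)"
      using k D(2)[OF uw m(2)] D(2)[OF w m(1)] unfolding eq by blast
    then show ?thesis using D(1)[OF uw m(2)] D(1)[OF w m(1)] unfolding eq by simp
  qed
  have D_v: "D (v + w) = K v + D w" if w: "w \<in> L" for w
  proof -
    define m where "m = max (M w) (M (v + w))"
    have m: "M w \<le> Suc m" "M (v + w) \<le> m" by (auto simp: m_def)
    have vw: "v + w \<in> L" using v CL w L_add by blast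
    have eq: "real m *\<^sub>R v + (v + w) = real (Suc m) *\<^sub>R v + w"
      by (simp only: of_nat_Suc scaleR_left_distrib scaleR_one add_ac)
    show ?thesis
      using D(1)[OF vw m(2)] D(1)[OF w m(1)] unfolding eq by (simp add: algebra_simps)
  qed
  show ?thesis
    using D_sub D_hom D_le D_v D_add by (intro exI[of _ D] conjI ballI allI impI) simp_all
qed

text \<open>An integral Hahn-Banach theorem. The invariant for a set \<open>B\<close> of basis
  vectors is that \<open>D\<close> changes by a constant under each shift by an element of
  \<open>B\<close>; once \<open>B\<close> contains all of them, \<open>D\<close> is linear, and
  these integer constants are the coordinates of \<open>a\<close>.\<close>

lemma integral_sublinear_support:
  fixes K :: "real ^ 'n \<Rightarrow> int"
  assumes sub: "\<And>w w'. w \<in> points_over \<int> \<Longrightarrow> w' \<in> points_over \<int> \<Longrightarrow> K (w + w') \<le> K w + K w'"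
    and hom: "\<And>w n. w \<in> points_over \<int> \<Longrightarrow> n \<ge> 1 \<Longrightarrow> K (real n *\<^sub>R w) = int n * K w"
  shows "\<exists>a\<in>points_over \<int>. \<forall>w\<in>points_over \<int>. a \<bullet> w \<le> of_int (K w)"
proof -
  let ?L = "points_over \<int> :: (real ^ 'n) set"
  have ex: "\<exists>D. (\<forall>w\<in>?L. \<forall>w'\<in>?L. D (w + w') \<le> D w + D w') \<and>
           (\<forall>w\<in>?L. \<forall>n\<ge>1. D (real n *\<^sub>R w) = int n * D w) \<and>
           (\<forall>w\<in>?L. D w \<le> K w) \<and> (\<forall>b\<in>B. \<exists>k. \<forall>w\<in>?L. D (b + w) = k + D w)"
    if "finite B" "B \<subseteq> ?L" for B
    using that
  proof (induction B rule: finite_induct)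
    case empty
    show ?case using sub hom by (intro exI[of _ K]) simp
  next
    case (insert v B)
    then have "B \<subseteq> ?L" by simp
    from insert.IH[OF this] obtain D where D': "\<forall>w\<in>?L. \<forall>w'\<in>?L. D (w + w') \<le> D w + D w'"
      "\<forall>w\<in>?L. \<forall>n\<ge>1. D (real n *\<^sub>R w) = int n * D w"
      "\<forall>w\<in>?L. D w \<le> K w" "\<forall>b\<in>B. \<exists>k. \<forall>w\<in>?L. D (b + w) = k + D w"
      by blast
    note D = D'(1,2,3)[rule_format] D'(4)
    have v: "v \<in> ?L" using insert by simp
    have "\<exists>D'. (\<forall>w\<in>?L. \<forall>w'\<in>?L. D' (w + w') \<le> D' w + D' w') \<and>
             (\<forall>w\<in>?L. \<forall>n\<ge>1. D' (real n *\<^sub>R w) = int n * D' w) \<and>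
             (\<forall>w\<in>?L. D' w \<le> D w) \<and>
             (\<forall>w\<in>?L. D' (v + w) = D v + D' w) \<and>
             (\<forall>u\<in>?L. \<forall>k. (\<forall>w\<in>?L. u + w \<in> ?L \<longrightarrow> D (u + w) = k + D w) \<longrightarrow>
                (\<forall>w\<in>?L. D' (u + w) = k + D' w))"
      by (rule directional_derivative) (use D(1,2) v in \<open>auto intro!: exI[of _ 0]\<close>)
    then obtain D' where D': "\<forall>w\<in>?L. \<forall>w'\<in>?L. D' (w + w') \<le> D' w + D' w'"
      "\<forall>w\<in>?L. \<forall>n\<ge>1. D' (real n *\<^sub>R w) = int n * D' w"
      "\<forall>w\<in>?L. D' w \<le> D w" "\<forall>w\<in>?L. D' (v + w) = D v + D' w"
      "\<And>u k. u \<in> ?L \<Longrightarrow> (\<forall>w\<in>?L. u + w \<in> ?L \<longrightarrow> D (u + w) = k + D w) \<Longrightarrow>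
                (\<forall>w\<in>?L. D' (u + w) = k + D' w)"
      by blast
    have "\<exists>k. \<forall>w\<in>?L. D' (b + w) = k + D' w" if "b \<in> insert v B" for b
    proof (cases "b = v")
      case True
      then show ?thesis using D'(4) by blast
    next
      case False
      then have b: "b \<in> B" using that by simp
      then obtain k where "\<forall>w\<in>?L. D (b + w) = k + D w" using D(4) by blast
      then show ?thesis using D'(5)[of b k] b insert by blast
    qed
    moreover have "\<forall>w\<in>?L. D' w \<le> K w" using D'(3) D(3) by (meson order_trans)
    ultimately show ?case using D'(1,2) by blast
  qed
  let ?e = "\<lambda>i. axis i 1 :: real ^ 'n"
  have fin: "finite (range ?e)" "range ?e \<subseteq> ?L" by auto
  obtain D where D: "\<forall>w\<in>?L. \<forall>n\<ge>1. D (real n *\<^sub>R w) = int n * D w"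
    "\<forall>w\<in>?L. D w \<le> K w" "\<forall>b\<in>range ?e. \<exists>k. \<forall>w\<in>?L. D (b + w) = k + D w"
    using ex[OF fin] by blast
  then have "\<forall>i. \<exists>k. \<forall>w\<in>?L. D (?e i + w) = k + D w" by blast
  from choice[OF this] obtain k where k: "\<And>i w. w \<in> ?L \<Longrightarrow> D (?e i + w) = k i + D w" by blast
  have k_nat: "D (real n *\<^sub>R ?e i + w) = int n * k i + D w" if w: "w \<in> ?L" for n i w
  proof (induction n)
    case (Suc n)
    have "real (Suc n) *\<^sub>R ?e i + w = ?e i + (real n *\<^sub>R ?e i + w)" by (simp add: algebra_simps)
    then show ?case using k[of "real n *\<^sub>R ?e i + w" i] Suc w by (simp add: algebra_simps)
  qed simp
  have k_int: "D (of_int n *\<^sub>R ?e i + w) = n * k i + D w" if w: "w \<in> ?L" for n i w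
  proof (cases "n \<ge> 0")
    case True
    then show ?thesis using k_nat[OF w, of "nat n" i] by simp
  next
    case False
    then show ?thesis using k_nat[of "of_int n *\<^sub>R ?e i + w" "nat (- n)" i] w
      by (simp flip: add.assoc)
  qed
  have D0: "D 0 = 0" using D(1)[rule_format, of 0 2] by simp
  define a :: "real ^ 'n" where "a = (\<chi> i. of_int (k i))"
  have "a \<bullet> w \<le> of_int (K w)" if w: "w \<in> ?L" for w
  proof -
    have "\<forall>i. \<exists>m. w $ i = of_int m" using w unfolding points_over_def by (auto elim: Ints_cases)
    from choice[OF this] obtain m where m: "\<And>i. w $ i = of_int (m i)" by blast
    have "D (\<Sum>i\<in>I. of_int (m i) *\<^sub>R ?e i) = (\<Sum>i\<in>I. m i * k i) \<and> (\<Sum>i\<in>I. of_int (m i) *\<^sub>R ?e i) \<in> ?L"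
      if "finite I" for I
      using that by (induction I rule: finite_induct) (simp_all add: D0 k_int)
    then have "D w = (\<Sum>i\<in>UNIV. m i * k i)"
      using vec_eq_sum_axis[of w] m by simp
    then have "a \<bullet> w = of_int (D w)"
      by (simp add: a_def inner_vec_def m mult.commute)
    then show ?thesis using D(2) w by simp
  qed
  moreover have "a \<in> ?L" by (simp add: a_def points_over_def)
  ultimately show ?thesis by blast
qed

text \<open>The assumption \<open>absorb\<close> says that \<open>C\<close> is open in
  \<open>L\<close>. Hence a single derivative, at any \<open>v\<close> in \<open>C\<close>, is
  already defined on all of \<open>L\<close>, and composing it with the projection \<open>P\<close>
  makes it sublinear on the full lattice. Since it minorizes \<open>K\<close> on \<open>C\<close>,
  so does any linear minorant of it.\<close>

lemma integral_sublinear_support_on_cone: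
  fixes K :: "real ^ 'n \<Rightarrow> int" and C L :: "(real ^ 'n) set"
  assumes C_add: "\<And>w w'. w \<in> C \<Longrightarrow> w' \<in> C \<Longrightarrow> w + w' \<in> C"
    and L_add: "\<And>w w'. w \<in> L \<Longrightarrow> w' \<in> L \<Longrightarrow> w + w' \<in> L"
    and L_neg: "\<And>w. w \<in> L \<Longrightarrow> - w \<in> L"
    and CL: "C \<subseteq> L" "L \<subseteq> points_over \<int>" "C \<noteq> {}"
    and absorb: "\<And>v w. v \<in> C \<Longrightarrow> w \<in> L \<Longrightarrow> \<exists>N. real N *\<^sub>R v + w \<in> C"
    and sub: "\<And>w w'. w \<in> C \<Longrightarrow> w' \<in> C \<Longrightarrow> K (w + w') \<le> K w + K w'"
    and hom: "\<And>w n. w \<in> C \<Longrightarrow> n \<ge> 1 \<Longrightarrow> K (real n *\<^sub>R w) = int n * K w"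
    and P: "linear P" "\<And>w. w \<in> points_over \<int> \<Longrightarrow> P w \<in> L" "\<And>w. w \<in> L \<Longrightarrow> P w = w"
  shows "\<exists>a\<in>points_over \<int>. \<forall>w\<in>C. a \<bullet> w \<le> of_int (K w)"
proof -
  obtain v where v: "v \<in> C" using CL by blast
  from directional_derivative[where K = K, OF C_add L_add L_neg CL(1) absorb sub hom v]
  obtain D where D: "\<And>w w'. w \<in> L \<Longrightarrow> w' \<in> L \<Longrightarrow> D (w + w') \<le> D w + D w'"
    "\<And>w n. w \<in> L \<Longrightarrow> n \<ge> 1 \<Longrightarrow> D (real n *\<^sub>R w) = int n * D w"
    "\<And>w. w \<in> C \<Longrightarrow> D w \<le> K w"
    by blast
  have "\<exists>a\<in>points_over \<int>. \<forall>w\<in>points_over \<int>. a \<bullet> w \<le> of_int (D (P w))"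
    by (rule integral_sublinear_support)
      (simp_all add: linear_add[OF P(1)] linear_cmul[OF P(1)] P(2) D)
  then obtain a where a: "a \<in> points_over \<int>" "\<And>w. w \<in> points_over \<int> \<Longrightarrow> a \<bullet> w \<le> of_int (D (P w))"
    by blast
  have "a \<bullet> w \<le> of_int (K w)" if w: "w \<in> C" for w
  proof -
    have "w \<in> L" "w \<in> points_over \<int>" using w CL by auto
    then have "a \<bullet> w \<le> of_int (D w)" using a(2)[of w] P(3)[of w] by simp
    also have "of_int (D w) \<le> (of_int (K w) :: real)" using D(3)[OF w] by simp
    finally show ?thesis .
  qed
  then show ?thesis using a(1) by blast
qed

section \<open>Subfields, rational lines and finiteness of bounded lattice vectors\<close>

lemma
  assumes "real_subfield F"
  shows real_subfield_add: "x \<in> F \<Longrightarrow> y \<in> F \<Longrightarrow> x + y \<in> F"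
    and real_subfield_mult: "x \<in> F \<Longrightarrow> y \<in> F \<Longrightarrow> x * y \<in> F"
    and real_subfield_minus: "x \<in> F \<Longrightarrow> - x \<in> F"
    and real_subfield_diff: "x \<in> F \<Longrightarrow> y \<in> F \<Longrightarrow> x - y \<in> F"
    and real_subfield_divide: "x \<in> F \<Longrightarrow> y \<in> F \<Longrightarrow> x / y \<in> F"
    and real_subfield_of_nat: "real n \<in> F"
    and real_subfield_Ints: "x \<in> \<int> \<Longrightarrow> x \<in> F"
    and real_subfield_Rats: "x \<in> \<rat> \<Longrightarrow> x \<in> F"
    and real_subfield_sum: "(\<And>i. i \<in> A \<Longrightarrow> g i \<in> F) \<Longrightarrow> sum g A \<in> F"
proof -
  have 0: "0 \<in> F" "1 \<in> F" and add: "\<And>x y. x \<in> F \<Longrightarrow> y \<in> F \<Longrightarrow> x + y \<in> F"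
    and mult: "\<And>x y. x \<in> F \<Longrightarrow> y \<in> F \<Longrightarrow> x * y \<in> F" and minus: "\<And>x. x \<in> F \<Longrightarrow> - x \<in> F"
    and inv: "\<And>x. x \<in> F \<Longrightarrow> x \<noteq> 0 \<Longrightarrow> inverse x \<in> F"
    using assms by (auto simp: real_subfield_def)
  have divide: "x / y \<in> F" if "x \<in> F" "y \<in> F" for x y
    using mult[OF that(1) inv[OF that(2)]] 0 by (cases "y = 0") (auto simp: divide_inverse)
  have nat: "real n \<in> F" for n by (induction n) (use 0 add in auto)
  have int: "x \<in> F" if x: "x \<in> \<int>" for x
  proof -
    obtain k where k: "x = of_int k" using x by (auto elim: Ints_cases)
    show ?thesis
      using nat[of "nat k"] minus[OF nat[of "nat (- k)"]] unfolding k by (cases "k \<ge> 0") auto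
  qed
  show "x \<in> F \<Longrightarrow> y \<in> F \<Longrightarrow> x + y \<in> F" by (rule add)
  show "x \<in> F \<Longrightarrow> y \<in> F \<Longrightarrow> x * y \<in> F" by (rule mult)
  show "x \<in> F \<Longrightarrow> - x \<in> F" by (rule minus)
  show "x \<in> F \<Longrightarrow> y \<in> F \<Longrightarrow> x - y \<in> F" using add[of x "- y"] minus[of y] by simp
  show "x \<in> F \<Longrightarrow> y \<in> F \<Longrightarrow> x / y \<in> F" by (rule divide)
  show "real n \<in> F" by (rule nat)
  show "x \<in> \<int> \<Longrightarrow> x \<in> F" by (rule int)
  show "x \<in> \<rat> \<Longrightarrow> x \<in> F"
    by (elim Rats_cases') (auto intro!: divide intro: int)
  show "(\<And>i. i \<in> A \<Longrightarrow> g i \<in> F) \<Longrightarrow> sum g A \<in> F"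
    by (induction A rule: infinite_finite_induct) (use 0 add in auto)
qed

lemma F_rational_line_through:
  fixes z w :: "real ^ 'n"
  assumes F: "real_subfield F" and z: "z \<in> points_over F" and w: "w \<in> points_over \<int>" "w \<noteq> 0"
  shows "F_rational_line F (range (\<lambda>t. z + t *\<^sub>R w))"
proof -
  have hull: "range (\<lambda>t. z + t *\<^sub>R w) = affine hull {z, z + w}"
    by (simp add: affine_hull_2_alt)
  \<comment> \<open>These are the 2 by 2 minors of the pair \<open>(w, x)\<close>: a vector is
    parallel to \<open>w\<close> iff all of them vanish. Swapping \<open>i\<close> and
    \<open>j\<close> changes the sign, so the inequalities alone force equality.\<close>
  define a :: "'n \<Rightarrow> 'n \<Rightarrow> real ^ 'n" where "a i j = w $ i *\<^sub>R axis j 1 - w $ j *\<^sub>R axis i 1" for i j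
  have a: "a i j \<in> points_over \<int>" for i j using w by (simp add: a_def points_over_def axis_def)
  have a_inner: "a i j \<bullet> x = w $ i * x $ j - w $ j * x $ i" for i j x
    by (simp add: a_def inner_diff_left inner_axis')
  \<comment> \<open>Zero vectors are left out because a halfspace needs a nonzero linear part. In
    dimension one nothing remains, and the line is the whole space.\<close>
  define H where "H = (\<lambda>(i, j). (a i j, - (a i j \<bullet> z))) ` {(i, j). a i j \<noteq> 0}"
  have "range (\<lambda>t. z + t *\<^sub>R w) = (\<Inter>l\<in>H. {x. affine_eval l x \<ge> 0})"
  proof (intro equalityI subsetI)
    fix x assume "x \<in> range (\<lambda>t. z + t *\<^sub>R w)"
    then obtain t where x: "x = z + t *\<^sub>R w" by blast
    show "x \<in> (\<Inter>l\<in>H. {x. affine_eval l x \<ge> 0})"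
      unfolding x H_def affine_eval_def by (auto simp: inner_add_right a_inner)
  next
    fix x assume x: "x \<in> (\<Inter>l\<in>H. {x. affine_eval l x \<ge> 0})"
    have ge: "a i j \<bullet> (x - z) \<ge> 0" for i j
    proof (cases "a i j = 0")
      case False
      then have "(a i j, - (a i j \<bullet> z)) \<in> H" unfolding H_def by auto
      then show ?thesis using x by (force simp: affine_eval_def inner_diff_right)
    qed simp
    have eq: "w $ i * (x - z) $ j = w $ j * (x - z) $ i" for i j
      using ge[of i j] ge[of j i] unfolding a_inner by linarith
    obtain i where i: "w $ i \<noteq> 0" using w by (auto simp: vec_eq_iff)
    have "x = z + ((x - z) $ i / w $ i) *\<^sub>R w"
      using eq[of i] i by (simp add: vec_eq_iff field_simps)
    then show "x \<in> range (\<lambda>t. z + t *\<^sub>R w)" by blast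
  qed
  moreover have "finite H" unfolding H_def by (rule finite_imageI) (rule finite)
  moreover have "F_integral_functional F l \<and> fst l \<noteq> 0" if "l \<in> H" for l
  proof -
    obtain i j where l: "l = (a i j, - (a i j \<bullet> z))" "a i j \<noteq> 0"
      using \<open>l \<in> H\<close> unfolding H_def by auto
    have "a i j \<bullet> z \<in> F"
      unfolding a_inner using w z
      by (auto simp: points_over_def 
          intro!: real_subfield_diff[OF F] real_subfield_mult[OF F] intro: real_subfield_Ints[OF F])
    then show ?thesis
      using a[of i j] l by (simp add: F_integral_functional_def points_over_def real_subfield_minus[OF F])
  qed
  ultimately have "F_rational_polyhedral F (range (\<lambda>t. z + t *\<^sub>R w))"
    unfolding F_rational_polyhedral_def by blast
  then show ?thesis
    unfolding F_rational_line_def hull using w by (simp add: aff_dim_2)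
qed

lemma common_denominator:
  fixes s :: "real ^ 'm"
  assumes "\<forall>i. s $ i \<in> \<rat>"
  shows "\<exists>d\<ge>1. real d *\<^sub>R s \<in> points_over \<int>"
proof -
  have "\<exists>d\<ge>1. \<forall>i\<in>A. real d * s $ i \<in> \<int>" if "finite A" for A
    using that
  proof (induction A rule: finite_induct)
    case (insert i A)
    then obtain d where d: "d \<ge> 1" "\<forall>i\<in>A. real d * s $ i \<in> \<int>" by blast
    obtain a b where ab: "b > 0" "s $ i = of_int a / of_int b"
      using assms by (meson Rats_cases')
    have "real (d * nat b) * s $ i = of_int (int d * a)" using ab by simp
    then have "real (d * nat b) * s $ i \<in> \<int>" by (metis Ints_of_int)
    moreover have "real (d * nat b) * s $ j \<in> \<int>" if "j \<in> A" for j
    proof -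
      have "real (d * nat b) * s $ j = real (nat b) * (real d * s $ j)" by simp
      then show ?thesis using d(2) that by (metis Ints_mult Ints_of_nat)
    qed
    moreover have "d * nat b \<ge> 1" using d(1) ab(1) by simp
    ultimately show ?case by blast
  qed auto
  from this[of UNIV] show ?thesis by (auto simp: points_over_def)
qed

lemma finite_bounded_Ints_vectors:
  fixes b :: real
  shows "finite {v :: real ^ 'm. \<forall>j. v $ j \<in> \<int> \<and> \<bar>v $ j\<bar> \<le> b}"
proof -
  define S where "S = real_of_int ` {- \<lceil>b\<rceil>..\<lceil>b\<rceil>}"
  have "v \<in> vec_lambda ` (UNIV \<rightarrow>\<^sub>E S)" if v: "\<forall>j. v $ j \<in> \<int> \<and> \<bar>v $ j\<bar> \<le> b" for v :: "real ^ 'm"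
  proof (rule image_eqI)
    show "v = vec_lambda (\<lambda>j. v $ j)" by simp
    have "v $ j \<in> S" for j
    proof -
      obtain k where k: "v $ j = of_int k" using v by (meson Ints_cases)
      have "\<bar>real_of_int k\<bar> \<le> b" using v[rule_format, of j] k by simp
      then have "k \<in> {- \<lceil>b\<rceil>..\<lceil>b\<rceil>}" by simp linarith
      then show ?thesis unfolding S_def k by blast
    qed
    then show "(\<lambda>j. v $ j) \<in> UNIV \<rightarrow>\<^sub>E S" by auto
  qed
  moreover have "finite (vec_lambda ` (UNIV \<rightarrow>\<^sub>E S) :: (real ^ 'm) set)"
    by (intro finite_imageI finite_PiE) (auto simp: S_def)
  ultimately show ?thesis by (elim finite_subset[rotated]) blast
qed

text \<open>With \<open>E\<close> the implicit equalities and \<open>J\<close> the other constraints of the polyhedron,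
  \<open>stratum F E J {}\<close> is its relative interior over \<open>F\<close>, and \<open>stratum F E J I\<close> is the part of its
  boundary where exactly the constraints in \<open>I\<close> are tight.\<close>

definition stratum ::
    "real set \<Rightarrow> ((real ^ 'n) \<times> real) set \<Rightarrow> ((real ^ 'n) \<times> real) set \<Rightarrow> ((real ^ 'n) \<times> real) set \<Rightarrow> (real ^ 'n) set" where
  "stratum F E J I = {x \<in> points_over F. (\<forall>l\<in>E \<union> I. affine_eval l x = 0) \<and> (\<forall>l\<in>J - I. affine_eval l x > 0)}"

lemma affine_eval_add: "affine_eval l (x + v) = affine_eval l x + fst l \<bullet> v"
  by (simp add: affine_eval_def inner_add_right)

text \<open>A pair \<open>(k, c)\<close> stands for the function \<open>c + k * t\<close>. Just to
  the right of 0 the lexicographic order decides: greatest value at 0 first, then greatest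
  slope.\<close>

lemma Max_affine_germ:
  fixes M :: "(real \<times> real) set"
  assumes "finite M" "M \<noteq> {}"
  shows "\<exists>m\<in>M. \<forall>\<^sub>F t in at_right 0. \<forall>m'\<in>M. snd m' + fst m' * t \<le> snd m + fst m * t"
proof -
  define c where "c = Max (snd ` M)"
  define N where "N = {m \<in> M. snd m = c}"
  have "c \<in> snd ` M" unfolding c_def using assms by (intro Max_in) auto
  then have "N \<noteq> {}" "finite N" using assms by (auto simp: N_def)
  then have "Max (fst ` N) \<in> fst ` N" by (intro Max_in) auto
  then obtain m where m: "m \<in> N" "fst m = Max (fst ` N)" by auto
  have "\<forall>\<^sub>F t in at_right 0. snd m' + fst m' * t \<le> snd m + fst m * t" if m': "m' \<in> M" for m'
  proof (cases "snd m' = c")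
    case True
    then have "fst m' \<le> fst m" unfolding m(2) using m' \<open>finite N\<close> by (intro Max_ge) (auto simp: N_def)
    then show ?thesis
      using eventually_at_right_less[of "0::real"] True m(1)
      by (auto elim!: eventually_mono simp: N_def mult_right_mono)
  next
    case False
    moreover have "snd m' \<le> c" unfolding c_def using m' assms by (intro Max_ge) auto
    ultimately have "snd m' < c" by simp
    moreover have "((\<lambda>t. (snd m' + fst m' * t) - (snd m + fst m * t)) \<longlongrightarrow>
        (snd m' + fst m' * 0) - (snd m + fst m * 0)) (at_right 0)"
      by (intro tendsto_intros)
    ultimately have "\<forall>\<^sub>F t in at_right 0. (snd m' + fst m' * t) - (snd m + fst m * t) < 0"
      using m(1) by (intro order_tendstoD) (auto simp: N_def)
    then show ?thesis by (auto elim!: eventually_mono)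
  qed
  then show ?thesis
    using m(1) assms by (intro bexI[of _ m]) (auto simp: N_def eventually_ball_finite_distrib)
qed

section \<open>One-sided behaviour along integral directions\<close>

text \<open>Parameters \<open>t\<close> tend to 0 from the right inside \<open>F\<close>, because
  only these keep \<open>z + t *\<^sub>R w\<close> in \<open>F^n\<close>, where the hypothesis
  controls \<open>f\<close>. The filter is proper since \<open>F\<close> contains the reciprocals of
  the positive integers.\<close>

abbreviation small_in :: "real set \<Rightarrow> real filter" where
  "small_in F \<equiv> at 0 within (F \<inter> {0<..})"

text \<open>The argument uses only the constraints and their strata. The relative interior is
  translated into this language once, at the end.\<close>

locale integral_polyhedral_on_lines =
  fixes F :: "real set" and E J :: "((real ^ 'n) \<times> real) set" and f :: "real ^ 'n \<Rightarrow> real"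
  assumes F: "real_subfield F"
    and fin: "finite E" "finite J"
    and functional: "\<And>l. l \<in> E \<union> J \<Longrightarrow> F_integral_functional F l"
    and lines: "\<And>L. F_rational_line F L \<Longrightarrow> F_integral_polyhedral_on F (stratum F E J {} \<inter> L) f"
begin

lemmas F_add = real_subfield_add[OF F]
  and F_mult = real_subfield_mult[OF F]
  and F_minus = real_subfield_minus[OF F]
  and F_diff = real_subfield_diff[OF F]
  and F_divide = real_subfield_divide[OF F]
  and F_nat = real_subfield_of_nat[OF F]
  and F_Ints = real_subfield_Ints[OF F]
  and F_Rats = real_subfield_Rats[OF F]
  and F_sum = real_subfield_sum[OF F]

lemma F_01: "0 \<in> F" "1 \<in> F"
  using F_nat[of 0] F_nat[of 1] by auto

lemma small_neq_bot: "small_in F \<noteq> bot"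
proof -
  have "\<exists>t\<in>F \<inter> {0<..}. t \<noteq> 0 \<and> dist t 0 < e" if e: "e > 0" for e :: real
  proof -
    obtain n where "inverse (real (Suc n)) < e" using reals_Archimedean[OF e] by blast
    moreover have "inverse (real (Suc n)) \<in> F"
      using F_divide[OF F_01(2) F_nat[of "Suc n"]] by (simp add: inverse_eq_divide)
    ultimately show ?thesis by (intro bexI[of _ "inverse (real (Suc n))"]) auto
  qed
  then show ?thesis
    by (simp add: trivial_limit_within islimpt_approachable)
qed

lemma small_pos: "\<forall>\<^sub>F t in small_in F. t \<in> F \<and> 0 < t"
  by (auto simp: eventually_at_filter)

lemma eventually_small_at_right: "eventually P (at_right 0) \<Longrightarrow> eventually P (small_in F)"
  by (rule filter_leD[OF at_le]) auto

lemma filterlim_small_scale: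
  assumes "r \<in> F" "r > 0"
  shows "filterlim (\<lambda>t. r * t) (small_in F) (small_in F)"
  unfolding filterlim_at
proof (intro conjI)
  have "((\<lambda>t. r * t) \<longlongrightarrow> r * 0) (small_in F)" by (intro tendsto_intros)
  then show "((\<lambda>t. r * t) \<longlongrightarrow> 0) (small_in F)" by simp
  show "\<forall>\<^sub>F t in small_in F. r * t \<in> F \<inter> {0<..} \<and> r * t \<noteq> 0"
    using small_pos assms F_mult by (auto elim!: eventually_mono)
qed

lemma eventually_small_scale:
  "eventually Q (small_in F) \<Longrightarrow> r \<in> F \<Longrightarrow> r > 0 \<Longrightarrow> \<forall>\<^sub>F t in small_in F. Q (r * t)"
  using filterlim_small_scale unfolding filterlim_iff by blast

text \<open>Let \<open>t\<close> tend to 0; if the constants agree, cancel them and divide by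
  \<open>t\<close>. Every inequality between limits or slopes at a boundary point is read off in
  this way.\<close>

lemma small_affine_le:
  assumes "\<forall>\<^sub>F t in small_in F. c + k * t \<le> c' + k' * t"
  shows "c \<le> c'" and "c = c' \<Longrightarrow> k \<le> k'"
proof -
  have "((\<lambda>t. c + k * t) \<longlongrightarrow> c + k * 0) (small_in F)"
    "((\<lambda>t. c' + k' * t) \<longlongrightarrow> c' + k' * 0) (small_in F)"
    by (intro tendsto_intros)+
  from tendsto_le[OF small_neq_bot this(2,1) assms] show "c \<le> c'" by simp
  assume "c = c'"
  have "\<forall>\<^sub>F t in small_in F. k \<le> k'"
    by (rule eventually_elim2[OF assms small_pos]) (simp add: \<open>c = c'\<close>)
  then show "k \<le> k'" using small_neq_bot by simp
qed

lemma small_affine_eq: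
  assumes "\<forall>\<^sub>F t in small_in F. c + k * t = c' + k' * t"
  shows "c = c' \<and> k = k'"
proof -
  have "\<forall>\<^sub>F t in small_in F. c + k * t \<le> c' + k' * t" "\<forall>\<^sub>F t in small_in F. c' + k' * t \<le> c + k * t"
    using assms by (auto elim!: eventually_mono)
  then show ?thesis using small_affine_le by (metis order_antisym)
qed

lemma points_over_add_scale:
  assumes "z \<in> points_over F" "w \<in> points_over \<int>" "t \<in> F"
  shows "z + t *\<^sub>R w \<in> points_over F"
  using assms F_Ints by (auto simp: points_over_def intro!: F_add F_mult)

lemma fst_points_over: "l \<in> E \<union> J \<Longrightarrow> fst l \<in> points_over \<int>"
  using functional by (auto simp: F_integral_functional_def points_over_def)

lemma affine_eval_in_F:
  assumes "l \<in> E \<union> J" "z \<in> points_over F"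
  shows "affine_eval l z \<in> F"
  using functional[OF assms(1)] assms(2) F_Ints
  by (auto simp: affine_eval_def F_integral_functional_def points_over_def inner_vec_def
      intro!: F_add F_sum F_mult)

abbreviation rel_domain ("X") where "X \<equiv> stratum F E J {}"

lemma stratum_points_over: "z \<in> stratum F E J I \<Longrightarrow> z \<in> points_over F"
  by (simp add: stratum_def)

lemma line_Max:
  assumes z: "z \<in> points_over F" and w: "w \<in> points_over \<int>"
  shows "\<exists>M :: (real \<times> real) set. finite M \<and> M \<noteq> {} \<and>
    (\<forall>m\<in>M. fst m \<in> \<int> \<and> (w \<noteq> 0 \<longrightarrow> snd m \<in> F)) \<and>
    (\<forall>t\<in>F. z + t *\<^sub>R w \<in> X \<longrightarrow> f (z + t *\<^sub>R w) = Max ((\<lambda>m. snd m + fst m * t) ` M))"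
proof (cases "w = 0")
  case True
  show ?thesis by (rule exI[of _ "{(0, f z)}"]) (auto simp: True)
next
  case False
  obtain N where N: "finite N" "N \<noteq> {}" "\<And>l. l \<in> N \<Longrightarrow> F_integral_functional F l"
    "\<And>x. x \<in> X \<inter> range (\<lambda>t. z + t *\<^sub>R w) \<Longrightarrow> f x = Max ((\<lambda>l. affine_eval l x) ` N)"
    using lines[OF F_rational_line_through[OF F z w False]]
    unfolding F_integral_polyhedral_on_def by blast
  have N_Ints: "fst l \<in> points_over \<int>" if "l \<in> N" for l
    using N(3)[OF that] by (auto simp: F_integral_functional_def points_over_def)
  have N_inner: "fst l \<bullet> w \<in> \<int>" if "l \<in> N" for l
    using inner_Ints[OF N_Ints[OF that] w] .
  have N_F: "affine_eval l z \<in> F" if "l \<in> N" for l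
    using N(3)[OF that] z F_Ints
    by (auto simp: affine_eval_def F_integral_functional_def points_over_def inner_vec_def
      intro!: F_add F_sum F_mult)
  have N_line: "f (z + t *\<^sub>R w) = Max ((\<lambda>m. snd m + fst m * t) ` (\<lambda>l. (fst l \<bullet> w, affine_eval l z)) ` N)"
    if "t \<in> F" "z + t *\<^sub>R w \<in> X" for t
  proof -
    have "z + t *\<^sub>R w \<in> X \<inter> range (\<lambda>t. z + t *\<^sub>R w)" using that by blast
    from N(4)[OF this] show ?thesis by (simp add: image_image affine_eval_add mult.commute)
  qed
  show ?thesis
    by (rule exI[of _ "(\<lambda>l. (fst l \<bullet> w, affine_eval l z)) ` N"])
      (use N(1,2) N_inner N_F N_line in \<open>simp del: split_paired_All\<close>)
qed

text \<open>The piece that dominates just after \<open>z\<close> serves all purposes: being one of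
  the pieces, it lies below \<open>f\<close> on the whole line, and its slope is an integer. For
  \<open>z\<close> on the boundary, \<open>c\<close> is the radial limit that replaces the missing
  value of \<open>f\<close>.\<close>

lemma germ:
  assumes z: "z \<in> points_over F" and w: "w \<in> points_over \<int>"
    and ev: "\<forall>\<^sub>F t in small_in F. z + t *\<^sub>R w \<in> X"
  shows "\<exists>k c. k \<in> \<int> \<and> (\<forall>\<^sub>F t in small_in F. f (z + t *\<^sub>R w) = c + k * t) \<and>
    (\<forall>t\<in>F. z + t *\<^sub>R w \<in> X \<longrightarrow> c + k * t \<le> f (z + t *\<^sub>R w)) \<and> (z \<in> X \<longrightarrow> c = f z)"
proof -
  obtain M where "finite M" "M \<noteq> {}" "\<forall>m\<in>M. fst m \<in> \<int>"
    "\<forall>t\<in>F. z + t *\<^sub>R w \<in> X \<longrightarrow> f (z + t *\<^sub>R w) = Max ((\<lambda>m. snd m + fst m * t) ` M)"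
    using line_Max[OF z w] by blast
  note M = this[rule_format]
  obtain m where m: "m \<in> M"
    "\<forall>\<^sub>F t in at_right 0. \<forall>m'\<in>M. snd m' + fst m' * t \<le> snd m + fst m * t"
    using Max_affine_germ[OF M(1,2)] by blast
  have Max_eq: "Max ((\<lambda>m. snd m + fst m * t) ` M) = snd m + fst m * t"
    if "\<forall>m'\<in>M. snd m' + fst m' * t \<le> snd m + fst m * t" for t
    using that M(1) m(1) by (intro Max_eqI) auto
  have "fst m \<in> \<int> \<and> (\<forall>\<^sub>F t in small_in F. f (z + t *\<^sub>R w) = snd m + fst m * t) \<and>
    (\<forall>t\<in>F. z + t *\<^sub>R w \<in> X \<longrightarrow> snd m + fst m * t \<le> f (z + t *\<^sub>R w)) \<and> (z \<in> X \<longrightarrow> snd m = f z)"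
  proof (intro conjI ballI impI)
    show "fst m \<in> \<int>" using M(3) m(1) .
    show "\<forall>\<^sub>F t in small_in F. f (z + t *\<^sub>R w) = snd m + fst m * t"
      using ev small_pos eventually_small_at_right[OF m(2)]
      by eventually_elim (use M(4) Max_eq in simp)
    show "snd m + fst m * t \<le> f (z + t *\<^sub>R w)" if "t \<in> F" "z + t *\<^sub>R w \<in> X" for t
      unfolding M(4)[OF that] using M(1) m(1) by (intro Max_ge) auto
    assume "z \<in> X"
    then have "f z = Max ((\<lambda>m. snd m + fst m * 0) ` M)" using M(4)[of 0] F_01 by simp
    also have "\<dots> = snd m + fst m * 0"
    proof (rule Max_eq, intro ballI)
      fix m' assume "m' \<in> M"
      then have "\<forall>\<^sub>F t in small_in F. snd m' + fst m' * t \<le> snd m + fst m * t"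
        using eventually_small_at_right[OF m(2)] by (auto elim!: eventually_mono)
      then show "snd m' + fst m' * 0 \<le> snd m + fst m * 0" using small_affine_le(1) by simp
    qed
    finally show "snd m = f z" by simp
  qed
  then show ?thesis by blast
qed

text \<open>The piece attaining the maximum at the intermediate point lies below \<open>f\<close> at
  both ends.\<close>

lemma convex_along:
  assumes x: "x \<in> X" and w: "w \<in> points_over \<int>" and t: "t \<in> F" "x + t *\<^sub>R w \<in> X"
    and r: "r \<in> F" "0 \<le> r" "r \<le> 1" "x + (r * t) *\<^sub>R w \<in> X"
  shows "f (x + (r * t) *\<^sub>R w) \<le> (1 - r) * f x + r * f (x + t *\<^sub>R w)"
proof -
  obtain M where "finite M" "M \<noteq> {}"
    "\<forall>t\<in>F. x + t *\<^sub>R w \<in> X \<longrightarrow> f (x + t *\<^sub>R w) = Max ((\<lambda>m. snd m + fst m * t) ` M)"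
    using line_Max[OF stratum_points_over[OF x] w] by blast
  note M = this[rule_format]
  have "Max ((\<lambda>m. snd m + fst m * (r * t)) ` M) \<in> (\<lambda>m. snd m + fst m * (r * t)) ` M"
    using M by (intro Max_in) auto
  then obtain m where m: "m \<in> M" "f (x + (r * t) *\<^sub>R w) = snd m + fst m * (r * t)"
    using M(3)[OF F_mult[OF r(1) t(1)] r(4)] by (auto simp del: split_paired_All split_paired_Ex)
  have "snd m + fst m * 0 \<le> f x"
    using M(3)[of 0] F_01 x M(1) m(1) by (auto intro!: Max_ge)
  moreover have "snd m + fst m * t \<le> f (x + t *\<^sub>R w)"
    using M(3)[OF t] M(1) m(1) by (auto intro!: Max_ge)
  ultimately have "(1 - r) * (snd m + fst m * 0) + r * (snd m + fst m * t) \<le>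
      (1 - r) * f x + r * f (x + t *\<^sub>R w)"
    using r by (intro add_mono mult_left_mono) auto
  then show ?thesis unfolding m(2) by (simp add: algebra_simps)
qed

lemma eventually_in_dom:
  assumes z: "z \<in> stratum F E J I" and w: "w \<in> points_over \<int>"
    and wE: "\<And>l. l \<in> E \<Longrightarrow> fst l \<bullet> w = 0" and wI: "\<And>l. l \<in> I \<Longrightarrow> fst l \<bullet> w > 0"
  shows "\<forall>\<^sub>F t in small_in F. z + t *\<^sub>R w \<in> X"
proof -
  have "\<forall>\<^sub>F t in small_in F. affine_eval l (z + t *\<^sub>R w) > 0" if l: "l \<in> J" for l
  proof (cases "l \<in> I")
    case True
    then have "affine_eval l z = 0" using z by (auto simp: stratum_def)
    then show ?thesis using small_pos wI[OF True]
      by (auto elim!: eventually_mono simp: affine_eval_add)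
  next
    case False
    then have "affine_eval l z > 0" using z l by (auto simp: stratum_def)
    moreover have "((\<lambda>t. affine_eval l z + t * (fst l \<bullet> w)) \<longlongrightarrow> affine_eval l z + 0 * (fst l \<bullet> w)) (small_in F)"
      by (intro tendsto_intros)
    ultimately have "\<forall>\<^sub>F t in small_in F. affine_eval l z + t * (fst l \<bullet> w) > 0"
      by (intro order_tendstoD) auto
    then show ?thesis by (simp add: affine_eval_add)
  qed
  then have "\<forall>\<^sub>F t in small_in F. \<forall>l\<in>J. affine_eval l (z + t *\<^sub>R w) > 0"
    using fin by (simp add: eventually_ball_finite_distrib)
  then show ?thesis
    using small_pos
  proof eventually_elim
    case (elim t)
    then show ?case
      using z w wE points_over_add_scale by (auto simp: stratum_def affine_eval_add)
  qed
qed

lemma tendsto_along: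
  assumes x: "x \<in> X" and w: "w \<in> points_over \<int>" and wE: "\<And>l. l \<in> E \<Longrightarrow> fst l \<bullet> w = 0"
  shows "((\<lambda>t. f (x + t *\<^sub>R w)) \<longlongrightarrow> f x) (small_in F)"
proof -
  have "\<forall>\<^sub>F t in small_in F. x + t *\<^sub>R w \<in> X" by (rule eventually_in_dom[OF x w wE]) auto
  from germ[OF stratum_points_over[OF x] w this] obtain k c where
    kc: "\<forall>\<^sub>F t in small_in F. f (x + t *\<^sub>R w) = c + k * t" and c: "c = f x"
    using x by blast
  have "((\<lambda>t. c + k * t) \<longlongrightarrow> c + k * 0) (small_in F)" by (intro tendsto_intros)
  then have "((\<lambda>t. f (x + t *\<^sub>R w)) \<longlongrightarrow> c + k * 0) (small_in F)"
    using kc by (simp cong: tendsto_cong)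
  then show ?thesis using c by simp
qed

lemma f_in_F:
  assumes x: "x \<in> X"
  shows "f x \<in> F"
proof -
  \<comment> \<open>Any nonzero integral vector will do, even one not parallel to the domain: the
    line only has to pass through \<open>x\<close>, where the value of \<open>f\<close> is a
    constant term of one of its pieces.\<close>
  define w :: "real ^ 'n" where "w = axis undefined 1"
  have w: "w \<in> points_over \<int>" "w \<noteq> 0" by (auto simp: w_def axis_eq_0_iff)
  obtain M :: "(real \<times> real) set" where "finite M" "M \<noteq> {}"
    "\<forall>m\<in>M. w \<noteq> 0 \<longrightarrow> snd m \<in> F"
    "\<forall>t\<in>F. x + t *\<^sub>R w \<in> X \<longrightarrow> f (x + t *\<^sub>R w) = Max ((\<lambda>m. snd m + fst m * t) ` M)"
    using line_Max[OF stratum_points_over[OF x] w(1)] by blast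
  note M = this[rule_format]
  have "f x = Max (snd ` M)" using M(4)[of 0] x F_01 by simp
  also have "\<dots> \<in> snd ` M" using M by (intro Max_in) auto
  finally show ?thesis using M(3) x w(2) by auto
qed

section \<open>Supports and their existence\<close>

text \<open>The point \<open>z\<close> may lie outside \<open>X\<close>, so \<open>c\<close> takes
  the place of \<open>f z\<close>. The existential part makes the support tight: \<open>c\<close> is
  the limit of \<open>f\<close> along some integral direction into the domain.\<close>

definition supports :: "real ^ 'n \<Rightarrow> real ^ 'n \<Rightarrow> real \<Rightarrow> bool" where
  "supports z a c \<longleftrightarrow> a \<in> points_over \<int> \<and> (\<forall>y\<in>X. c + a \<bullet> (y - z) \<le> f y) \<and>
     (\<exists>v\<in>points_over \<int>. (\<forall>l\<in>E. fst l \<bullet> v = 0) \<and> (\<forall>\<^sub>F t in small_in F. z + t *\<^sub>R v \<in> X) \<and>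
        ((\<lambda>t. f (z + t *\<^sub>R v)) \<longlongrightarrow> c) (small_in F))"

text \<open>Follow the first minorant along the direction that realizes \<open>c'\<close> and pass
  to the limit. This is the subgradient inequality, valid between boundary points as well.\<close>

lemma supports_compare:
  assumes "supports z a c" "supports z' a' c'"
  shows "c + a \<bullet> (z' - z) \<le> c'"
proof -
  obtain v where v: "\<forall>\<^sub>F t in small_in F. z' + t *\<^sub>R v \<in> X"
    "((\<lambda>t. f (z' + t *\<^sub>R v)) \<longlongrightarrow> c') (small_in F)"
    using assms(2) unfolding supports_def by blast
  have "((\<lambda>t. c + a \<bullet> (z' + t *\<^sub>R v - z)) \<longlongrightarrow> c + a \<bullet> (z' + 0 *\<^sub>R v - z)) (small_in F)"
    by (intro tendsto_intros)
  moreover have "\<forall>\<^sub>F t in small_in F. c + a \<bullet> (z' + t *\<^sub>R v - z) \<le> f (z' + t *\<^sub>R v)"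
    using v(1) assms(1) unfolding supports_def by (auto elim!: eventually_mono)
  ultimately show ?thesis using tendsto_le[OF small_neq_bot v(2)] by auto
qed

lemma supports_value:
  assumes "supports x a c" "x \<in> X"
  shows "c = f x"
proof -
  obtain v where v: "v \<in> points_over \<int>" "\<forall>l\<in>E. fst l \<bullet> v = 0" "((\<lambda>t. f (x + t *\<^sub>R v)) \<longlongrightarrow> c) (small_in F)"
    using assms(1) unfolding supports_def by blast
  show ?thesis
    using tendsto_unique[OF small_neq_bot v(3) tendsto_along[OF assms(2) v(1)]] v(2) by blast
qed

text \<open>For \<open>w\<close> in the cone \<open>C\<close> of integral directions pointing from \<open>z\<close> into the domain,
  \<open>f (z + t w) = G w + K w t\<close> for small \<open>t\<close>. The function \<open>G\<close> is convex and homogeneous of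
  degree 0 on an open cone, hence constant; then \<open>K\<close> is sublinear, and an integral linear minorant
  of \<open>K\<close> is a support of \<open>f\<close> at \<open>z\<close>.\<close>

lemma supports_exists:
  assumes z: "z \<in> stratum F E J I" and I: "I \<subseteq> J" and x0: "x0 \<in> X"
  shows "\<exists>a c. supports z a c"
proof -
  have zF: "z \<in> points_over F" using z by (rule stratum_points_over)
  have finI: "finite I" using I fin finite_subset by blast
  have "finite (fst ` E)" "fst ` E \<subseteq> points_over \<int>" using fin fst_points_over by auto
  from integral_projection[OF this] obtain P where P: "linear P"
    "\<And>w. w \<in> points_over \<int> \<Longrightarrow> P w \<in> points_over \<int>"
    "\<And>l w. l \<in> E \<Longrightarrow> fst l \<bullet> P w = 0" "\<And>w. (\<forall>l\<in>E. fst l \<bullet> w = 0) \<Longrightarrow> P w = w"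
    by auto
  define L where "L = {w \<in> points_over \<int>. \<forall>l\<in>E. fst l \<bullet> w = 0}"
  define C where "C = {w \<in> L. \<forall>l\<in>I. fst l \<bullet> w > 0}"
  have L_add: "w + w' \<in> L" if "w \<in> L" "w' \<in> L" for w w'
    using that by (auto simp: L_def inner_add_right)
  have L_neg: "- w \<in> L" if "w \<in> L" for w using that by (auto simp: L_def)
  have CL: "C \<subseteq> L" "L \<subseteq> points_over \<int>" by (auto simp: C_def L_def)
  have C_Ints: "w \<in> points_over \<int>" if "w \<in> C" for w using that CL by blast
  have C_add: "w + w' \<in> C" if "w \<in> C" "w' \<in> C" for w w'
    using that L_add by (auto simp: C_def inner_add_right add_pos_pos)
  have C_scale: "real n *\<^sub>R w \<in> C" if "w \<in> C" "n \<ge> 1" for w n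
    using that by (auto simp: C_def L_def)
  have absorb: "\<exists>N\<ge>1. real N *\<^sub>R v + w \<in> C" if v: "v \<in> C" and w: "w \<in> L" for v w
  proof -
    have "\<forall>\<^sub>F n in sequentially. fst l \<bullet> (real n *\<^sub>R v + w) > 0" if "l \<in> I" for l
    proof -
      have "fst l \<bullet> v > 0" using v that by (auto simp: C_def)
      then have "filterlim (\<lambda>n. fst l \<bullet> w + (fst l \<bullet> v) * real n) at_top sequentially"
        by (intro filterlim_tendsto_add_at_top[OF tendsto_const]
            filterlim_tendsto_pos_mult_at_top[OF tendsto_const] filterlim_real_sequentially)
      then have "\<forall>\<^sub>F n in sequentially. fst l \<bullet> w + (fst l \<bullet> v) * real n > 0"
        by (simp add: filterlim_at_top_dense)
      then show ?thesis by (simp add: inner_add_right algebra_simps)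
    qed
    then have "\<forall>\<^sub>F n in sequentially. \<forall>l\<in>I. fst l \<bullet> (real n *\<^sub>R v + w) > 0"
      using finI by (simp add: eventually_ball_finite_distrib)
    then have "\<forall>\<^sub>F n in sequentially. n \<ge> 1 \<and> (\<forall>l\<in>I. fst l \<bullet> (real n *\<^sub>R v + w) > 0)"
      using eventually_ge_at_top[of 1] by eventually_elim simp
    then obtain N where N: "N \<ge> 1" "\<forall>l\<in>I. fst l \<bullet> (real N *\<^sub>R v + w) > 0"
      using eventually_happens'[OF sequentially_bot] by blast
    moreover have "real N *\<^sub>R v + w \<in> L"
      using C_scale[OF v N(1)] CL(1) L_add w by blast
    ultimately show ?thesis by (auto simp: C_def)
  qed
  \<comment> \<open>\<open>C\<close> is nonempty: round a large multiple of
    \<open>d = x0 - z\<close> to a lattice vector and project it back by \<open>P\<close>. The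
    projected rounding error changes \<open>fst l\<close> by at most the constant \<open>B\<close>,
    while \<open>fst l \<bullet> d > 0\<close> is multiplied by \<open>n\<close>.\<close>
  obtain v where v: "v \<in> C"
  proof -
    define d where "d = x0 - z"
    have d_E: "fst l \<bullet> d = 0" if "l \<in> E" for l
      using x0 z that affine_eval_add[of l z d] by (auto simp: stratum_def d_def)
    have d_I: "fst l \<bullet> d > 0" if "l \<in> I" for l
    proof -
      have "affine_eval l x0 > 0" "affine_eval l z = 0" using x0 z that I by (auto simp: stratum_def)
      then show ?thesis using affine_eval_add[of l z d] by (simp add: d_def)
    qed
    define q :: "nat \<Rightarrow> real ^ 'n" where "q n = (\<chi> i. of_int \<lfloor>real n * d $ i\<rfloor>)" for n
    have q: "q n \<in> points_over \<int>" for n by (simp add: q_def points_over_def)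
    have "\<forall>\<^sub>F n in sequentially. fst l \<bullet> P (q n) > 0" if l: "l \<in> I" for l
    proof -
      define B where "B = (\<Sum>i\<in>UNIV. \<bar>fst l \<bullet> P (axis i 1)\<bar>)"
      have ge: "fst l \<bullet> P (q n) \<ge> real n * (fst l \<bullet> d) - B" for n
      proof -
        define r where "r = real n *\<^sub>R d - q n"
        have r: "\<bar>r $ i\<bar> \<le> 1" for i by (simp add: r_def q_def) linarith
        have "P r = (\<Sum>i\<in>UNIV. r $ i *\<^sub>R P (axis i 1))"
          by (subst vec_eq_sum_axis[of r]) (simp add: linear_sum[OF P(1)] linear_cmul[OF P(1)])
        then have "fst l \<bullet> P r = (\<Sum>i\<in>UNIV. r $ i * (fst l \<bullet> P (axis i 1)))"
          by (simp add: inner_sum_right)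
        also have "\<dots> \<le> B" unfolding B_def
        proof (rule sum_mono)
          fix i
          have "r $ i * (fst l \<bullet> P (axis i 1)) \<le> \<bar>r $ i\<bar> * \<bar>fst l \<bullet> P (axis i 1)\<bar>"
            by (simp flip: abs_mult)
          also have "\<dots> \<le> 1 * \<bar>fst l \<bullet> P (axis i 1)\<bar>" using r by (intro mult_right_mono) auto
          finally show "r $ i * (fst l \<bullet> P (axis i 1)) \<le> \<bar>fst l \<bullet> P (axis i 1)\<bar>" by simp
        qed
        finally have "fst l \<bullet> P r \<le> B" .
        moreover have "P r = real n *\<^sub>R d - P (q n)"
          unfolding r_def linear_diff[OF P(1)] linear_cmul[OF P(1)] using P(4) d_E by simp
        ultimately show ?thesis by (simp add: inner_diff_right)
      qed
      have "filterlim (\<lambda>n. - B + (fst l \<bullet> d) * real n) at_top sequentially"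
        by (intro filterlim_tendsto_add_at_top[OF tendsto_const]
            filterlim_tendsto_pos_mult_at_top[OF tendsto_const d_I[OF l]] filterlim_real_sequentially)
      from filterlim_at_top_dense[THEN iffD1, OF this, rule_format, of 0]
      show ?thesis
      proof eventually_elim
        case (elim n)
        then show ?case using ge[of n] by (simp add: mult.commute)
      qed
    qed
    then have "\<forall>\<^sub>F n in sequentially. \<forall>l\<in>I. fst l \<bullet> P (q n) > 0"
      using finI by (simp add: eventually_ball_finite_distrib)
    then obtain n where "\<forall>l\<in>I. fst l \<bullet> P (q n) > 0"
      using eventually_happens'[OF sequentially_bot] by blast
    then have "P (q n) \<in> C" using P(2,3) q by (simp add: C_def L_def)
    then show thesis by (rule that)
  qed
  have ev: "\<forall>\<^sub>F t in small_in F. z + t *\<^sub>R w \<in> X" if "w \<in> C" for w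
    by (rule eventually_in_dom[OF z]) (use that in \<open>auto simp: C_def L_def\<close>)
  have "\<forall>w. \<exists>k c. w \<in> C \<longrightarrow> (\<forall>\<^sub>F t in small_in F. f (z + t *\<^sub>R w) = c + real_of_int k * t) \<and>
    (\<forall>t\<in>F. z + t *\<^sub>R w \<in> X \<longrightarrow> c + real_of_int k * t \<le> f (z + t *\<^sub>R w))"
  proof
    fix w
    show "\<exists>k c. w \<in> C \<longrightarrow> (\<forall>\<^sub>F t in small_in F. f (z + t *\<^sub>R w) = c + real_of_int k * t) \<and>
      (\<forall>t\<in>F. z + t *\<^sub>R w \<in> X \<longrightarrow> c + real_of_int k * t \<le> f (z + t *\<^sub>R w))"
    proof (cases "w \<in> C")
      case True
      from germ[OF zF C_Ints[OF True] ev[OF True]] obtain r c where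
        r: "r \<in> \<int>" "\<forall>\<^sub>F t in small_in F. f (z + t *\<^sub>R w) = c + r * t"
        "\<forall>t\<in>F. z + t *\<^sub>R w \<in> X \<longrightarrow> c + r * t \<le> f (z + t *\<^sub>R w)" by blast
      obtain k where "r = of_int k" using r(1) by (rule Ints_cases)
      then show ?thesis using r(2,3) by blast
    qed blast
  qed
  from choice[OF this] obtain K where "\<forall>w. \<exists>c. w \<in> C \<longrightarrow>
    (\<forall>\<^sub>F t in small_in F. f (z + t *\<^sub>R w) = c + real_of_int (K w) * t) \<and>
    (\<forall>t\<in>F. z + t *\<^sub>R w \<in> X \<longrightarrow> c + real_of_int (K w) * t \<le> f (z + t *\<^sub>R w))" by blast
  from choice[OF this] obtain G where GK: "\<forall>w. w \<in> C \<longrightarrow>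
    (\<forall>\<^sub>F t in small_in F. f (z + t *\<^sub>R w) = G w + real_of_int (K w) * t) \<and>
    (\<forall>t\<in>F. z + t *\<^sub>R w \<in> X \<longrightarrow> G w + real_of_int (K w) * t \<le> f (z + t *\<^sub>R w))" by blast
  have g1: "\<forall>\<^sub>F t in small_in F. f (z + t *\<^sub>R w) = G w + real_of_int (K w) * t" if "w \<in> C" for w
    using GK that by blast
  have g2: "G w + real_of_int (K w) * t \<le> f (z + t *\<^sub>R w)"
    if "w \<in> C" "t \<in> F" "z + t *\<^sub>R w \<in> X" for w t
    using GK that by blast
  have scale: "G (real n *\<^sub>R w) = G w \<and> K (real n *\<^sub>R w) = int n * K w" if w: "w \<in> C" and n: "n \<ge> 1" for w n
  proof -
    have "\<forall>\<^sub>F t in small_in F. f (z + (real n * t) *\<^sub>R w) = G w + real_of_int (K w) * (real n * t)"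
      by (rule eventually_small_scale[OF g1[OF w]]) (use F_nat n in auto)
    then have "\<forall>\<^sub>F t in small_in F. G (real n *\<^sub>R w) + real_of_int (K (real n *\<^sub>R w)) * t =
        G w + (real n * real_of_int (K w)) * t"
      using g1[OF C_scale[OF w n]] by eventually_elim (simp add: algebra_simps)
    then have "G (real n *\<^sub>R w) = G w \<and> real_of_int (K (real n *\<^sub>R w)) = real n * real_of_int (K w)"
      by (rule small_affine_eq)
    then show ?thesis by (metis of_int_eq_iff of_int_mult of_int_of_nat_eq)
  qed
  \<comment> \<open>The point \<open>z + (p * t) *\<^sub>R (w + w')\<close> lies on the segment from
    \<open>z + ((p + 1) * t) *\<^sub>R w\<close> to
    \<open>z + ((p + 1) * p * t) *\<^sub>R w'\<close>, the far end having weight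
    \<open>1 / (p + 1)\<close>. The segment has the integral direction
    \<open>p *\<^sub>R w' - w\<close>, so convexity along it is available.\<close>
  have conv: "\<forall>\<^sub>F t in small_in F.
      real (p + 1) * G (w + w') + (real (p + 1) * real p * real_of_int (K (w + w'))) * t \<le>
      (real p * G w + G w') + (real p * real (p + 1) * (real_of_int (K w) + real_of_int (K w'))) * t"
    if w: "w \<in> C" "w' \<in> C" and p: "p \<ge> 1" for p w w'
  proof -
    note sc = eventually_small_scale
    have ww: "w + w' \<in> C" using C_add w by blast
    have pF: "real p \<in> F" "real (p + 1) \<in> F" "real (p + 1) * real p \<in> F"
      using F_nat[of p] F_nat[of "p + 1"] F_mult by blast+
    have pp: "real p > 0" "real (p + 1) > 0" "real (p + 1) * real p > 0" using p by auto
    have rF: "1 / real (p + 1) \<in> F" using F_divide[OF F_01(2) pF(2)] .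
    have wt: "real (p + 1) * ((1 - 1 / real (p + 1)) * b + 1 / real (p + 1) * b') = real p * b + b'" for b b'
    proof -
      have "q * ((1 - 1 / q) * b + 1 / q * b') = (q - 1) * b + b'" if "q > 0" for q :: real
        using that by (simp add: field_simps)
      from this[OF pp(2)] show ?thesis by simp
    qed
    show ?thesis
      using sc[OF ev[OF w(1)] pF(2) pp(2)] sc[OF ev[OF w(2)] pF(3) pp(3)]
        sc[OF ev[OF ww] pF(1) pp(1)]
        sc[OF g1[OF w(1)] pF(2) pp(2)] sc[OF g1[OF w(2)] pF(3) pp(3)]
        sc[OF g1[OF ww] pF(1) pp(1)] small_pos
    proof eventually_elim
      case (elim t)
      define x where "x = z + (real (p + 1) * t) *\<^sub>R w"
      define u where "u = real p *\<^sub>R w' - w"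
      have u: "u \<in> points_over \<int>" using w C_Ints by (simp add: u_def)
      have y: "x + (real (p + 1) * t) *\<^sub>R u = z + (real (p + 1) * real p * t) *\<^sub>R w'"
        by (simp add: x_def u_def algebra_simps)
      have m: "x + (1 / real (p + 1) * (real (p + 1) * t)) *\<^sub>R u = z + (real p * t) *\<^sub>R (w + w')"
      proof -
        have "1 / real (p + 1) * (real (p + 1) * t) = t" using pp(2) by simp
        then show ?thesis unfolding x_def u_def by (simp only:) (simp add: algebra_simps)
      qed
      have inX: "x \<in> X" "x + (real (p + 1) * t) *\<^sub>R u \<in> X"
        "x + (1 / real (p + 1) * (real (p + 1) * t)) *\<^sub>R u \<in> X"
        unfolding y m using elim by (simp_all only: x_def)
      have tF: "real (p + 1) * t \<in> F" using F_mult pF(2) elim by blast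
      have r01: "0 \<le> 1 / real (p + 1)" "1 / real (p + 1) \<le> 1" by simp_all
      have "f (z + (real p * t) *\<^sub>R (w + w')) \<le> (1 - 1 / real (p + 1)) * f x +
          1 / real (p + 1) * f (z + (real (p + 1) * real p * t) *\<^sub>R w')"
        using convex_along[OF inX(1) u tF inX(2) rF r01 inX(3)] unfolding y m .
      from mult_left_mono[OF this, of "real (p + 1)"]
      have "real (p + 1) * f (z + (real p * t) *\<^sub>R (w + w')) \<le>
          real p * f x + f (z + (real (p + 1) * real p * t) *\<^sub>R w')"
        unfolding wt using pp(2) by simp
      then show ?case using elim unfolding x_def by (simp add: algebra_simps)
    qed
  qed
  \<comment> \<open>Constant terms in \<open>conv\<close>: as \<open>p\<close> grows, the share of
    \<open>G w'\<close> becomes negligible.\<close>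
  have G_le: "G (w + w') \<le> G w" if w: "w \<in> C" "w' \<in> C" for w w'
  proof (rule ccontr)
    assume "\<not> G (w + w') \<le> G w"
    then have pos: "G (w + w') - G w > 0" by simp
    obtain p where p: "G w' - G (w + w') < real p * (G (w + w') - G w)"
      using reals_Archimedean3[OF pos] by blast
    also have "\<dots> \<le> real (Suc p) * (G (w + w') - G w)" using pos by (intro mult_right_mono) auto
    finally show False
      using small_affine_le(1)[OF conv[OF w, of "Suc p"]] by (simp add: algebra_simps)
  qed
  \<comment> \<open>Since \<open>C\<close> is open, a multiple of \<open>w\<close> is
    \<open>w'\<close> plus an element of \<open>C\<close>, and \<open>G\<close> ignores the
    multiple. Exchanging \<open>w\<close> and \<open>w'\<close> makes \<open>G\<close>
    constant.\<close>
  have G_le': "G w \<le> G w'" if w: "w \<in> C" "w' \<in> C" for w w'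
  proof -
    have "- w' \<in> L" using w L_neg CL by blast
    then obtain N where N: "N \<ge> 1" "real N *\<^sub>R w + - w' \<in> C" using absorb w(1) by blast
    have "G (w' + (real N *\<^sub>R w + - w')) \<le> G w'" by (rule G_le[OF w(2) N(2)])
    then show ?thesis using scale[OF w(1) N(1)] by simp
  qed
  then have G: "G w = G v" if "w \<in> C" for w using that v by (simp add: order_antisym)
  \<comment> \<open>With \<open>G\<close> constant the slopes in \<open>conv\<close> can be
    compared, and \<open>p = 1\<close> is enough.\<close>
  have K_sub: "K (w + w') \<le> K w + K w'" if w: "w \<in> C" "w' \<in> C" for w w'
  proof -
    have "G w = G v" "G w' = G v" "G (w + w') = G v" using G w C_add by blast+
    then have "real (1 + 1) * real 1 * real_of_int (K (w + w')) \<le>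
        real 1 * real (1 + 1) * (real_of_int (K w) + real_of_int (K w'))"
      by (intro small_affine_le(2)[OF conv[OF w order_refl]]) simp
    then show ?thesis by simp
  qed
  have "\<exists>a\<in>points_over \<int>. \<forall>w\<in>C. a \<bullet> w \<le> of_int (K w)"
  proof (rule integral_sublinear_support_on_cone[OF C_add L_add L_neg CL _ _ K_sub _ P(1)])
    show "C \<noteq> {}" using v by blast
    show "\<exists>N. real N *\<^sub>R v + w \<in> C" if "v \<in> C" "w \<in> L" for v w using absorb that by blast
    show "K (real n *\<^sub>R w) = int n * K w" if "w \<in> C" "1 \<le> n" for w n using scale that by blast
    show "P w \<in> L" if "w \<in> points_over \<int>" for w using that P(2,3) by (simp add: L_def)
    show "P w = w" if "w \<in> L" for w using that P(4) by (simp add: L_def)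
  qed
  then obtain a where a: "a \<in> points_over \<int>" "\<And>w. w \<in> C \<Longrightarrow> a \<bullet> w \<le> of_int (K w)" by blast
  \<comment> \<open>Induction on the number of irrational coordinates of \<open>s\<close>; the point
    tested is \<open>z + P s\<close>, so that changing a coordinate of \<open>s\<close> keeps it in
    the affine hull. With none left, a multiple of \<open>P s\<close> lies in \<open>C\<close>.
    Otherwise a failure at \<open>s\<close> would persist for small steps along the integral vector
    \<open>P (axis i 1)\<close>, one of which makes coordinate \<open>i\<close> rational.\<close>
  have supp: "G v + a \<bullet> P s \<le> f (z + P s)"
    if "s \<in> points_over F" "z + P s \<in> X" for s
    using that
  proof (induction "card {i. s $ i \<notin> \<rat>}" arbitrary: s rule: less_induct)
    case less
    show ?case
    proof (cases "\<forall>i. s $ i \<in> \<rat>")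
      case True
      then obtain d where d: "d \<ge> 1" "real d *\<^sub>R s \<in> points_over \<int>" using common_denominator by blast
      define w where "w = P (real d *\<^sub>R s)"
      have w_eq: "w = real d *\<^sub>R P s" by (simp add: w_def linear_cmul[OF P(1)])
      have "fst l \<bullet> P s > 0" if "l \<in> I" for l
      proof -
        have "affine_eval l (z + P s) > 0" "affine_eval l z = 0"
          using less.prems(2) z that I by (auto simp: stratum_def)
        then show ?thesis by (simp add: affine_eval_add)
      qed
      moreover have "w \<in> L" unfolding L_def w_def using P(2,3) d by blast
      ultimately have w: "w \<in> C" using d by (simp add: C_def w_eq)
      have s_eq: "P s = (1 / real d) *\<^sub>R w" using d by (simp add: w_eq)
      have dF: "1 / real d \<in> F" using F_divide F_01 F_nat by blast
      have "G v + real_of_int (K w) * (1 / real d) \<le> f (z + P s)"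
        using g2[OF w dF] less.prems(2) G[OF w] unfolding s_eq by simp
      moreover have "a \<bullet> P s \<le> real_of_int (K w) * (1 / real d)"
        unfolding s_eq using a(2)[OF w] d by (simp add: divide_right_mono)
      ultimately show ?thesis by linarith
    next
      case False
      then obtain i where i: "s $ i \<notin> \<rat>" by blast
      define u where "u = P (axis i 1)"
      have u: "u \<in> points_over \<int>" "\<And>l. l \<in> E \<Longrightarrow> fst l \<bullet> u = 0" using P(2,3) by (auto simp: u_def)
      show ?thesis
      proof (rule ccontr)
        assume "\<not> ?thesis"
        then have lt: "f (z + P s) - (G v + a \<bullet> P s) < 0" by simp
        have "((\<lambda>t. f (z + P s + t *\<^sub>R u) - (G v + a \<bullet> (P s + t *\<^sub>R u))) \<longlongrightarrow>
            f (z + P s) - (G v + a \<bullet> (P s + 0 *\<^sub>R u))) (small_in F)"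
          by (intro tendsto_intros tendsto_along less.prems u)
        from order_tendstoD(2)[OF this, of 0] lt
        have "\<forall>\<^sub>F t in small_in F. f (z + P s + t *\<^sub>R u) - (G v + a \<bullet> (P s + t *\<^sub>R u)) < 0" by simp
        moreover have "\<forall>\<^sub>F t in small_in F. z + P s + t *\<^sub>R u \<in> X"
          by (rule eventually_in_dom[OF less.prems(2) u]) auto
        ultimately have "\<forall>\<^sub>F t in small_in F. z + P s + t *\<^sub>R u \<in> X \<and>
            f (z + P s + t *\<^sub>R u) < G v + a \<bullet> (P s + t *\<^sub>R u)"
          by eventually_elim simp
        then obtain e where e: "e > 0" "\<And>t. t \<in> F \<Longrightarrow> 0 < t \<Longrightarrow> t < e \<Longrightarrow> z + P s + t *\<^sub>R u \<in> X \<and>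
            f (z + P s + t *\<^sub>R u) < G v + a \<bullet> (P s + t *\<^sub>R u)"
          by (auto simp: eventually_at)
        obtain r where r: "r \<in> \<rat>" "s $ i < r" "r < s $ i + e"
          using Rats_dense_in_real[of "s $ i" "s $ i + e"] e(1) by auto
        define t where "t = r - s $ i"
        have t: "t \<in> F" "0 < t" "t < e"
          using r less.prems(1) F_diff F_Rats by (auto simp: t_def points_over_def)
        define s' where "s' = s + t *\<^sub>R axis i 1"
        have Ps': "P s' = P s + t *\<^sub>R u"
          by (simp add: s'_def u_def linear_add[OF P(1)] linear_cmul[OF P(1)])
        have s'_nth: "s' $ j = (if j = i then r else s $ j)" for j
          by (auto simp: s'_def t_def axis_def)
        have "s' \<in> points_over F" using less.prems(1) r F_Rats by (auto simp: points_over_def s'_nth)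
        moreover have "{j. s' $ j \<notin> \<rat>} \<subset> {j. s $ j \<notin> \<rat>}" using i r by (auto simp: s'_nth)
        then have "card {j. s' $ j \<notin> \<rat>} < card {j. s $ j \<notin> \<rat>}" by (intro psubset_card_mono) auto
        moreover have "z + P s' \<in> X" using e(2)[OF t] by (simp add: Ps' add.assoc)
        ultimately have "G v + a \<bullet> P s' \<le> f (z + P s')" using less.hyps by blast
        then show False using e(2)[OF t] by (simp add: Ps' add.assoc)
      qed
    qed
  qed
  have "supports z a (G v)"
    unfolding supports_def
  proof (intro conjI ballI)
    show "a \<in> points_over \<int>" by (rule a)
    show "G v + a \<bullet> (y - z) \<le> f y" if y: "y \<in> X" for y
    proof -
      have "y - z \<in> points_over F"
        using stratum_points_over[OF y] zF F_diff by (auto simp: points_over_def)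
      moreover have "P (y - z) = y - z"
        using y z affine_eval_add[of _ z "y - z"] by (intro P(4)) (auto simp: stratum_def)
      ultimately show ?thesis using supp[of "y - z"] y by simp
    qed
    have "((\<lambda>t. G v + real_of_int (K v) * t) \<longlongrightarrow> G v + real_of_int (K v) * 0) (small_in F)"
      by (intro tendsto_intros)
    then have "((\<lambda>t. f (z + t *\<^sub>R v)) \<longlongrightarrow> G v) (small_in F)"
      using tendsto_cong[OF g1[OF v]] by simp
    then show "\<exists>u\<in>points_over \<int>. (\<forall>l\<in>E. fst l \<bullet> u = 0) \<and> (\<forall>\<^sub>F t in small_in F. z + t *\<^sub>R u \<in> X) \<and>
        ((\<lambda>t. f (z + t *\<^sub>R u)) \<longlongrightarrow> G v) (small_in F)"
      using v ev[OF v] CL by (auto simp: L_def C_def)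
  qed
  then show ?thesis by blast
qed

section \<open>Finiteness of the set of linear parts\<close>

text \<open>The bound is one-sided; it is applied to \<open>u\<close> and to \<open>- u\<close>. The
  set \<open>B\<close> comes from the induction over strata with more tight constraints.\<close>

lemma supports_slope_bound:
  assumes I: "I \<subseteq> J" and x0: "x0 \<in> X" and u: "u \<in> points_over \<int>" "\<And>l. l \<in> E \<union> I \<Longrightarrow> fst l \<bullet> u = 0"
    and B: "finite B" "\<And>I' z. I \<subset> I' \<Longrightarrow> I' \<subseteq> J \<Longrightarrow> z \<in> stratum F E J I' \<Longrightarrow> \<exists>a\<in>B. \<exists>c. supports z a c"
  shows "\<exists>b. \<forall>z\<in>stratum F E J I. \<forall>a c. supports z a c \<longrightarrow> a \<bullet> u \<le> b"
proof (cases "\<forall>l\<in>J - I. fst l \<bullet> u \<ge> 0")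
  case True
  \<comment> \<open>Here \<open>u\<close> is a recession direction. The ray starts at
    \<open>x0\<close> because \<open>f\<close> is controlled only on \<open>X\<close>; every
    support, wherever its base point, minorizes \<open>f\<close> on this one ray and cannot outgrow
    it.\<close>
  have ray: "x0 + t *\<^sub>R u \<in> X" if t: "t \<in> F" "t \<ge> 0" for t
  proof -
    have "affine_eval l (x0 + t *\<^sub>R u) > 0" if "l \<in> J" for l
    proof -
      have "fst l \<bullet> u \<ge> 0" using that True u(2)[of l] by (cases "l \<in> I") auto
      moreover have "affine_eval l x0 > 0" using x0 that by (auto simp: stratum_def)
      ultimately show ?thesis using t by (simp add: affine_eval_add add_pos_nonneg)
    qed
    then show ?thesis
      using x0 u t points_over_add_scale[OF stratum_points_over[OF x0] u(1)]
      by (auto simp: stratum_def affine_eval_add)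
  qed
  obtain M :: "(real \<times> real) set" where "finite M" "M \<noteq> {}"
    "\<forall>t\<in>F. x0 + t *\<^sub>R u \<in> X \<longrightarrow> f (x0 + t *\<^sub>R u) = Max ((\<lambda>m. snd m + fst m * t) ` M)"
    using line_Max[OF stratum_points_over[OF x0] u(1)] by blast
  note M = this[rule_format]
  define b where "b = Max (fst ` M)"
  define d where "d = Max (snd ` M)"
  have growth: "f (x0 + t *\<^sub>R u) \<le> d + b * t" if t: "t \<in> F" "t \<ge> 0" for t
  proof -
    have "snd m + fst m * t \<le> d + b * t" if "m \<in> M" for m
      using that M(1) t unfolding b_def d_def by (intro add_mono mult_right_mono Max_ge) auto
    then show ?thesis using M(3)[OF t(1) ray[OF t]] M(1,2) by simp
  qed
  have "a \<bullet> u \<le> b" if s: "supports z a c" for z a c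
  proof (rule ccontr)
    assume "\<not> ?thesis"
    then have pos: "a \<bullet> u - b > 0" by simp
    obtain n where n: "d - c - a \<bullet> (x0 - z) < real n * (a \<bullet> u - b)"
      using reals_Archimedean3[OF pos] by blast
    have "c + a \<bullet> (x0 + real n *\<^sub>R u - z) \<le> f (x0 + real n *\<^sub>R u)"
      using s ray[OF F_nat, of n] unfolding supports_def by simp
    also have "\<dots> \<le> d + b * real n" using growth[OF F_nat, of n] by simp
    finally show False using n by (simp add: inner_diff_right inner_add_right algebra_simps)
  qed
  then show ?thesis by blast
next
  case False
  define N where "N = {l \<in> J - I. fst l \<bullet> u < 0}"
  have "finite N" using fin by (simp add: N_def)
  moreover have "N \<noteq> {}" using False unfolding N_def not_le[symmetric] by blast
  ultimately have N: "finite N" "N \<noteq> {}" .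
  define b where "b = Max ((\<lambda>a. a \<bullet> u) ` insert 0 B)"
  have "a \<bullet> u \<le> b" if z: "z \<in> stratum F E J I" and s: "supports z a c" for z a c
  proof -
    have zF: "z \<in> points_over F" using z by (rule stratum_points_over)
    \<comment> \<open>\<open>q l\<close> is the time at which constraint \<open>l\<close> becomes
      tight on the way from \<open>z\<close> along \<open>u\<close>, and \<open>T\<close> the first
      such time. It lies in \<open>F\<close>, so the exit point \<open>z'\<close> is again a point
      of \<open>F^n\<close>.\<close>
    define q where "q l = affine_eval l z / - (fst l \<bullet> u)" for l
    define T where "T = Min (q ` N)"
    have T_in: "T \<in> q ` N" unfolding T_def using N by (intro Min_in) auto
    then obtain l0 where l0: "l0 \<in> N" "T = q l0" by blast
    have "affine_eval l0 z > 0" using z l0 by (auto simp: stratum_def N_def)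
    then have T_pos: "T > 0" using l0 by (simp add: q_def N_def divide_pos_neg)
    have "fst l0 \<bullet> u \<in> F" using l0 fst_points_over inner_Ints[OF _ u(1)] F_Ints by (auto simp: N_def)
    then have T_F: "T \<in> F"
      using l0 affine_eval_in_F[OF _ zF, of l0] F_divide F_minus by (auto simp: q_def N_def)
    define z' where "z' = z + T *\<^sub>R u"
    have z'_ge: "affine_eval l z' \<ge> 0" if l: "l \<in> J - I" for l
    proof (cases "l \<in> N")
      case True
      have "T \<le> q l" unfolding T_def using True N by (intro Min_le) auto
      moreover have "fst l \<bullet> u < 0" using True by (simp add: N_def)
      ultimately show ?thesis by (simp add: q_def z'_def affine_eval_add field_simps)
    next
      case False
      then have "fst l \<bullet> u \<ge> 0" using l by (auto simp: N_def)
      moreover have "affine_eval l z > 0" using z l by (auto simp: stratum_def)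
      ultimately show ?thesis using T_pos by (simp add: z'_def affine_eval_add)
    qed
    define I' where "I' = I \<union> {l \<in> J - I. affine_eval l z' = 0}"
    have "z' \<in> points_over F" unfolding z'_def by (rule points_over_add_scale[OF zF u(1) T_F])
    moreover have "affine_eval l z' = 0" if "l \<in> E \<union> I" for l
      using z that u(2)[OF that] by (auto simp: stratum_def z'_def affine_eval_add)
    moreover have "affine_eval l z' > 0" if "l \<in> J - I'" for l
      using z'_ge[of l] that by (auto simp: I'_def less_le)
    ultimately have z': "z' \<in> stratum F E J I'" by (auto simp: stratum_def I'_def)
    have "affine_eval l0 z' = 0"
      using l0 by (simp add: z'_def affine_eval_add q_def N_def field_simps)
    then have "I \<subset> I'" "I' \<subseteq> J" using l0 I by (auto simp: I'_def N_def)
    from B(2)[OF this z'] obtain a' c' where a': "a' \<in> B" "supports z' a' c'" by blast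
    \<comment> \<open>Adding the two subgradient inequalities gives the monotonicity
      \<open>a \<bullet> u \<le> a' \<bullet> u\<close>.\<close>
    have "c + a \<bullet> (z' - z) \<le> c'" "c' + a' \<bullet> (z - z') \<le> c"
      using supports_compare s a' by blast+
    then have "T * (a \<bullet> u) \<le> T * (a' \<bullet> u)" by (simp add: z'_def)
    then have "a \<bullet> u \<le> a' \<bullet> u" using T_pos by simp
    also have "\<dots> \<le> b" unfolding b_def using a' B(1) by (intro Max_ge) auto
    finally show ?thesis .
  qed
  then show ?thesis by blast
qed

text \<open>Only finitely many supports are needed on a stratum: along it, a support is determined by its
  slopes on finitely many integral directions. Following such a direction one either stays in the
  stratum forever, where the slope of \<open>f\<close> bounds that of the support, or reaches a smaller
  stratum, where convexity compares it with one of finitely many supports.\<close>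

lemma finitely_many_supports:
  assumes I: "I \<subseteq> J" and x0: "x0 \<in> X"
  shows "\<exists>A. finite A \<and> (\<forall>z\<in>stratum F E J I. \<exists>a\<in>A. \<exists>c. supports z a c)"
  using I
\<comment> \<open>Strata with more tight constraints come first; the open stratum is last.\<close>
proof (induction "card (J - I)" arbitrary: I rule: less_induct)
  case less
  have "\<forall>I'. \<exists>A. I \<subset> I' \<and> I' \<subseteq> J \<longrightarrow> finite A \<and> (\<forall>z\<in>stratum F E J I'. \<exists>a\<in>A. \<exists>c. supports z a c)"
  proof
    fix I'
    show "\<exists>A. I \<subset> I' \<and> I' \<subseteq> J \<longrightarrow> finite A \<and> (\<forall>z\<in>stratum F E J I'. \<exists>a\<in>A. \<exists>c. supports z a c)"
    proof (cases "I \<subset> I' \<and> I' \<subseteq> J")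
      case True
      then have "card (J - I') < card (J - I)" using fin by (intro psubset_card_mono) auto
      with less.hyps[of I'] True show ?thesis by blast
    qed blast
  qed
  from choice[OF this] obtain A where A: "\<forall>I'. I \<subset> I' \<and> I' \<subseteq> J \<longrightarrow>
      finite (A I') \<and> (\<forall>z\<in>stratum F E J I'. \<exists>a\<in>A I'. \<exists>c. supports z a c)"
    by blast
  define B where "B = (\<Union>I'\<in>{I'. I \<subset> I' \<and> I' \<subseteq> J}. A I')"
  have "finite {I'. I \<subset> I' \<and> I' \<subseteq> J}" by (rule finite_subset[of _ "Pow J"]) (use fin in auto)
  then have B: "finite B" unfolding B_def using A by (intro finite_UN_I) auto
  have B': "\<And>I' z. I \<subset> I' \<Longrightarrow> I' \<subseteq> J \<Longrightarrow> z \<in> stratum F E J I' \<Longrightarrow> \<exists>a\<in>B. \<exists>c. supports z a c"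
    unfolding B_def using A by blast
  have "finite (fst ` (E \<union> I))" "fst ` (E \<union> I) \<subseteq> points_over \<int>"
    using fin less.prems fst_points_over by (auto intro: finite_subset)
  from integral_projection[OF this] obtain P where P: "linear P"
    "\<And>w. w \<in> points_over \<int> \<Longrightarrow> P w \<in> points_over \<int>"
    "\<And>l w. l \<in> E \<union> I \<Longrightarrow> fst l \<bullet> P w = 0" "\<And>w. (\<forall>l\<in>E \<union> I. fst l \<bullet> w = 0) \<Longrightarrow> P w = w"
    by auto
  let ?e = "\<lambda>j. P (axis j 1)"
  have "\<exists>b. \<forall>z\<in>stratum F E J I. \<forall>a c. supports z a c \<longrightarrow> a \<bullet> ?e j \<le> b" for j
    by (rule supports_slope_bound[OF less.prems x0 _ _ B B']) (use P(2,3) in auto)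
  then have "\<forall>j. \<exists>b. \<forall>z\<in>stratum F E J I. \<forall>a c. supports z a c \<longrightarrow> a \<bullet> ?e j \<le> b" by blast
  from choice[OF this] obtain b where b: "\<And>j z a c. z \<in> stratum F E J I \<Longrightarrow> supports z a c \<Longrightarrow> a \<bullet> ?e j \<le> b j"
    by blast
  have "\<exists>b. \<forall>z\<in>stratum F E J I. \<forall>a c. supports z a c \<longrightarrow> a \<bullet> - ?e j \<le> b" for j
    by (rule supports_slope_bound[OF less.prems x0 _ _ B B']) (use P(2,3) in auto)
  then have "\<forall>j. \<exists>b. \<forall>z\<in>stratum F E J I. \<forall>a c. supports z a c \<longrightarrow> a \<bullet> - ?e j \<le> b" by blast
  from choice[OF this] obtain b' where b': "\<And>j z a c. z \<in> stratum F E J I \<Longrightarrow> supports z a c \<Longrightarrow> a \<bullet> - ?e j \<le> b' j"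
    by blast
  define T where "T = {a. \<exists>z\<in>stratum F E J I. \<exists>c. supports z a c}"
  \<comment> \<open>\<open>\<phi> a\<close> records the part of \<open>a\<close> that acts along the
    stratum, through the spanning vectors \<open>?e j\<close>. Bounded integer coordinates leave
    finitely many values.\<close>
  define \<phi> :: "real ^ 'n \<Rightarrow> real ^ 'n" where "\<phi> a = (\<chi> j. a \<bullet> ?e j)" for a
  define b0 where "b0 = (\<Sum>j\<in>UNIV. \<bar>b j\<bar> + \<bar>b' j\<bar>)"
  have "\<phi> a $ j \<in> \<int> \<and> \<bar>\<phi> a $ j\<bar> \<le> b0" if "a \<in> T" for a j
  proof -
    obtain z c where z: "z \<in> stratum F E J I" "supports z a c" using \<open>a \<in> T\<close> by (auto simp: T_def)
    have "a \<in> points_over \<int>" using z(2) by (simp add: supports_def)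
    then have "a \<bullet> ?e j \<in> \<int>" by (intro inner_Ints P(2)) simp_all
    moreover have "\<bar>b j\<bar> + \<bar>b' j\<bar> \<le> b0" unfolding b0_def by (rule member_le_sum) auto
    then have "\<bar>a \<bullet> ?e j\<bar> \<le> b0" using b[OF z, of j] b'[OF z, of j] by simp
    ultimately show ?thesis by (simp add: \<phi>_def)
  qed
  then have "finite (\<phi> ` T)" by (intro finite_subset[OF _ finite_bounded_Ints_vectors[of b0]]) auto
  then obtain A' where A': "A' \<subseteq> T" "finite A'" "\<phi> ` T = \<phi> ` A'"
    using finite_subset_image[OF _ order_refl, of \<phi> T] by blast
  have "\<exists>a\<in>A'. \<exists>c. supports z a c" if z: "z \<in> stratum F E J I" for z
  proof -
    obtain a c where a: "supports z a c" using supports_exists[OF z less.prems x0] by blast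
    then have "a \<in> T" using z by (auto simp: T_def)
    then obtain a' where a': "a' \<in> A'" "\<phi> a = \<phi> a'" using A'(3) by blast
    then obtain z' c' where z': "z' \<in> stratum F E J I" "supports z' a' c'" using A'(1) by (auto simp: T_def)
    have slope: "a \<bullet> P w = a' \<bullet> P w" for w
    proof -
      have "P w = (\<Sum>j\<in>UNIV. w $ j *\<^sub>R ?e j)"
        by (subst vec_eq_sum_axis[of w]) (simp add: linear_sum[OF P(1)] linear_cmul[OF P(1)])
      moreover have "a \<bullet> ?e j = a' \<bullet> ?e j" for j using a'(2) by (simp add: \<phi>_def vec_eq_iff)
      ultimately show ?thesis by (simp add: inner_sum_right)
    qed
    have "P (z' - z) = z' - z"
      using z z'(1) affine_eval_add[of _ z "z' - z"] by (intro P(4)) (auto simp: stratum_def)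
    then have "a \<bullet> (z' - z) = a' \<bullet> (z' - z)" using slope[of "z' - z"] by simp
    \<comment> \<open>The representative \<open>a'\<close> agrees with \<open>a\<close> along the
      stratum, though perhaps not across it. So its minorant through \<open>z'\<close> has height at
      least \<open>c\<close> at \<open>z\<close>; lowered to \<open>c\<close> it remains a minorant,
      and it inherits the tightness at \<open>z\<close> from \<open>a\<close>.\<close>
    then have c: "c \<le> c' + a' \<bullet> (z - z')"
      using supports_compare[OF a z'(2)] by (simp add: inner_diff_right)
    have "c + a' \<bullet> (y - z) \<le> f y" if "y \<in> X" for y
    proof -
      have "c' + a' \<bullet> (y - z') \<le> f y" using z'(2) that by (auto simp: supports_def)
      then show ?thesis using c by (simp add: inner_diff_right)
    qed
    then have "supports z a' c" using a z'(2) unfolding supports_def by blast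
    then show ?thesis using a'(1) by blast
  qed
  then show ?case using A'(2) by blast
qed

section \<open>Assembling the maximum\<close>

lemma integral_polyhedral: "F_integral_polyhedral_on F X f"
proof (cases "X = {}")
  case True
  then show ?thesis
    unfolding F_integral_polyhedral_on_def
    by (intro exI[of _ "{(0, 0)}"]) (auto simp: F_integral_functional_def F_01)
next
  case False
  then obtain x0 where x0: "x0 \<in> X" by blast
  obtain A where A: "finite A" "\<forall>x\<in>X. \<exists>a\<in>A. \<exists>c. supports x a c"
    using finitely_many_supports[OF empty_subsetI x0] by blast
  define A' where "A' = {a \<in> A. \<exists>x\<in>X. supports x a (f x)}"
  then have "\<forall>a\<in>A'. \<exists>x\<in>X. supports x a (f x)" by blast
  then obtain p where "\<forall>a\<in>A'. p a \<in> X \<and> supports (p a) a (f (p a))" by metis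
  then have p: "\<And>a. a \<in> A' \<Longrightarrow> p a \<in> X" "\<And>a. a \<in> A' \<Longrightarrow> supports (p a) a (f (p a))"
    by blast+
  define tangent where "tangent a = (a, f (p a) - a \<bullet> p a)" for a
  have tangent_eval: "affine_eval (tangent a) y = f (p a) + a \<bullet> (y - p a)" for a y
    by (simp add: tangent_def affine_eval_def inner_diff_right)
  have attained: "\<exists>a\<in>A'. affine_eval (tangent a) x \<ge> f x" if x: "x \<in> X" for x
  proof -
    obtain a c where a: "a \<in> A" "supports x a c" using A x by blast
    then have s: "supports x a (f x)" using supports_value[OF _ x] by blast
    then have a': "a \<in> A'" using a x by (auto simp: A'_def)
    \<comment> \<open>One base point per slope suffices: the support with slope \<open>a\<close> at
      \<open>x\<close> forces the tangent taken at \<open>p a\<close> to reach the height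
      \<open>f x\<close> at \<open>x\<close>.\<close>
    have "f x + a \<bullet> (p a - x) \<le> f (p a)" by (rule supports_compare[OF s p(2)[OF a']])
    then show ?thesis using a' unfolding tangent_eval by (intro bexI[of _ a]) (auto simp: inner_diff_right)
  qed
  have below: "affine_eval (tangent a) x \<le> f x" if "a \<in> A'" "x \<in> X" for a x
    using p(2)[OF that(1)] that(2) unfolding tangent_eval supports_def by blast
  have "F_integral_functional F (tangent a)" if a: "a \<in> A'" for a
  proof -
    have "a \<in> points_over \<int>" using p(2)[OF a] by (simp add: supports_def)
    moreover have "a \<bullet> p a \<in> F"
      using \<open>a \<in> points_over \<int>\<close> stratum_points_over[OF p(1)[OF a]] F_Ints
      by (auto simp: points_over_def inner_vec_def intro!: F_sum F_mult)
    ultimately show ?thesis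
      using f_in_F[OF p(1)[OF a]] F_diff by (simp add: F_integral_functional_def tangent_def points_over_def)
  qed
  moreover have "finite A'" using A(1) by (simp add: A'_def)
  moreover have "A' \<noteq> {}" using attained[OF x0] by blast
  moreover have "f x = Max ((\<lambda>l. affine_eval l x) ` tangent ` A')" if x: "x \<in> X" for x
  proof (rule sym, rule Max_eqI)
    show "finite ((\<lambda>l. affine_eval l x) ` tangent ` A')" using \<open>finite A'\<close> by simp
    show "y \<le> f x" if "y \<in> (\<lambda>l. affine_eval l x) ` tangent ` A'" for y using that below x by auto
    obtain a where a: "a \<in> A'" "affine_eval (tangent a) x \<ge> f x" using attained[OF x] by blast
    then have "f x = affine_eval (tangent a) x" using below x by (simp add: order_antisym)
    then show "f x \<in> (\<lambda>l. affine_eval l x) ` tangent ` A'" using a by blast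
  qed
  ultimately show ?thesis
    unfolding F_integral_polyhedral_on_def by (intro exI[of _ "tangent ` A'"]) auto
qed

end

section \<open>The relative interior in terms of constraints\<close>

text \<open>A point \<open>x\<close> is in the relative interior iff every segment from
  \<open>S\<close> to \<open>x\<close> can be prolonged a little beyond \<open>x\<close>. A
  constraint outside \<open>E\<close> is positive at some \<open>y\<close> in \<open>S\<close>; if
  it vanished at \<open>x\<close>, prolonging from \<open>y\<close> would make it negative.
  Conversely, finitely many constraints positive at \<open>x\<close> survive a short
  prolongation.\<close>

lemma rel_interior_polyhedral:
  fixes S :: "(real ^ 'n) set"
  assumes H: "finite H" and S: "S = (\<Inter>l\<in>H. {x. affine_eval l x \<ge> 0})" and ne: "S \<noteq> {}"
    and E: "E = {l \<in> H. \<forall>x\<in>S. affine_eval l x = 0}"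
  shows "rel_interior S \<inter> points_over F = stratum F E (H - E) {}"
proof -
  have affine: "affine_eval l ((1 - e) *\<^sub>R x + e *\<^sub>R y) = (1 - e) * affine_eval l x + e * affine_eval l y"
    for l e and x y :: "real ^ 'n"
    by (simp add: affine_eval_def inner_add_right algebra_simps)
  have mem: "x \<in> S \<longleftrightarrow> (\<forall>l\<in>H. affine_eval l x \<ge> 0)" for x by (auto simp: S)
  have "convex {x. affine_eval l x \<ge> 0}" for l :: "(real ^ 'n) \<times> real"
    unfolding convex_alt by (auto simp: affine)
  then have convex: "convex S" unfolding S by (intro convex_INT) auto
  have ri: "x \<in> rel_interior S \<longleftrightarrow> (\<forall>y\<in>S. \<exists>e>1. (1 - e) *\<^sub>R y + e *\<^sub>R x \<in> S)" for x
    by (rule convex_rel_interior_iff[OF convex ne])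
  have "x \<in> rel_interior S \<longleftrightarrow> (\<forall>l\<in>E. affine_eval l x = 0) \<and> (\<forall>l\<in>H - E. affine_eval l x > 0)" for x
  proof (intro iffI conjI ballI)
    fix l assume x: "x \<in> rel_interior S"
    then have xS: "x \<in> S" using rel_interior_subset by blast
    show "affine_eval l x = 0" if "l \<in> E" using that xS by (auto simp: E)
    assume l: "l \<in> H - E"
    then obtain y where y: "y \<in> S" "affine_eval l y \<noteq> 0" by (auto simp: E)
    then have "affine_eval l y > 0" using l mem[of y] by (auto simp: less_le)
    moreover obtain e where e: "e > 1" "(1 - e) *\<^sub>R y + e *\<^sub>R x \<in> S" using x y ri by blast
    then have "(1 - e) * affine_eval l y + e * affine_eval l x \<ge> 0" using l mem affine by auto
    ultimately have "e * affine_eval l x > 0" using e(1) mult_neg_pos[of "1 - e" "affine_eval l y"] by linarith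
    then show "affine_eval l x > 0" using e(1) by (simp add: zero_less_mult_iff)
  next
    assume x: "(\<forall>l\<in>E. affine_eval l x = 0) \<and> (\<forall>l\<in>H - E. affine_eval l x > 0)"
    have "\<exists>e>1. (1 - e) *\<^sub>R y + e *\<^sub>R x \<in> S" if y: "y \<in> S" for y
    proof -
      have "\<forall>\<^sub>F e in at_right 1. affine_eval l ((1 - e) *\<^sub>R y + e *\<^sub>R x) \<ge> 0" if l: "l \<in> H" for l
      proof (cases "l \<in> E")
        case True
        then have "affine_eval l x = 0" "affine_eval l y = 0" using x y by (simp, simp add: E)
        then show ?thesis by (simp add: affine)
      next
        case False
        have "((\<lambda>e. (1 - e) * affine_eval l y + e * affine_eval l x) \<longlongrightarrow>
            (1 - 1) * affine_eval l y + 1 * affine_eval l x) (at_right 1)"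
          by (intro tendsto_intros)
        then have "\<forall>\<^sub>F e in at_right 1. (1 - e) * affine_eval l y + e * affine_eval l x > 0"
          by (rule order_tendstoD) (use x l False in auto)
        then show ?thesis by eventually_elim (simp add: affine)
      qed
      then have "\<forall>\<^sub>F e in at_right 1. \<forall>l\<in>H. affine_eval l ((1 - e) *\<^sub>R y + e *\<^sub>R x) \<ge> 0"
        using H by (simp add: eventually_ball_finite_distrib)
      then have "\<forall>\<^sub>F e in at_right 1. e > 1 \<and> (1 - e) *\<^sub>R y + e *\<^sub>R x \<in> S"
        using eventually_at_right_less[of "1::real"] by eventually_elim (simp add: mem)
      then show ?thesis using eventually_happens'[of "at_right (1::real)"] by fastforce
    qed
    then show "x \<in> rel_interior S" using ri by blast
  qed
  then show ?thesis by (auto simp: stratum_def)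
qed

theorem corollary7p7:
  fixes F :: "real set"
    and S :: "(real ^ 'n) set"
    and f :: "real ^ 'n \<Rightarrow> real"
  assumes "real_subfield F"
    and "F_rational_polyhedral F S"
    and "\<And>L. F_rational_line F L \<Longrightarrow>
           F_integral_polyhedral_on F (rel_interior S \<inter> points_over F \<inter> L) f"
  shows "F_integral_polyhedral_on F (rel_interior S \<inter> points_over F) f"
\<comment> \<open>The description of the relative interior by prolonged segments requires a nonempty
  \<open>S\<close>.\<close>
proof (cases "S = {}")
  case True
  have "0 \<in> F" using assms(1) by (simp add: real_subfield_def)
  then show ?thesis
    unfolding F_integral_polyhedral_on_def True
    by (intro exI[of _ "{(0, 0)}"]) (auto simp: F_integral_functional_def)
next
  case False
  obtain H where H: "finite H" "\<forall>l\<in>H. F_integral_functional F l"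
    "S = (\<Inter>l\<in>H. {x. affine_eval l x \<ge> 0})"
    using assms(2) unfolding F_rational_polyhedral_def by blast
  define E where "E = {l \<in> H. \<forall>x\<in>S. affine_eval l x = 0}"
  note eq = rel_interior_polyhedral[OF H(1,3) False E_def, of F]
  interpret integral_polyhedral_on_lines F E "H - E" f
  proof
    show "real_subfield F" by (rule assms(1))
    show "finite E" "finite (H - E)" using H(1) by (auto simp: E_def)
    show "F_integral_functional F l" if "l \<in> E \<union> (H - E)" for l using that H(2) by (auto simp: E_def)
    show "F_integral_polyhedral_on F (stratum F E (H - E) {} \<inter> L) f" if "F_rational_line F L" for L
      using assms(3)[OF that] unfolding eq .
  qed
  show ?thesis unfolding eq by (rule integral_polyhedral)
qed

end
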